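(* The Gentzen system $\mathcal G_{\mathsf{RL}}$ is fully adequate for the logic $\models_{\mathsf{RL}}^{\leqslant}$; that is, the full g-models of $\models_{\mathsf{RL}}^{\leqslant}$ coincide with the models of $\mathcal G_{\mathsf{RL}}$.
   Context: All algebras have type $\langle\wedge,\vee,\star,\to,1,0\rangle$ with arities $(2,2,2,2,0,0)$. $\mathbf{Fm}$ is the algebra of formulas of this type (the absolutely free algebra over a countably infinite set of variables), with universe $Fm$. A residuated lattice (here always commutative and integral) is an algebra $\mathbf A$ such that $\langle A,\wedge,\vee\rangle$ is a lattice (order $\leqslant$) with maximum $1$, $\langle A,\star,1\rangle$ is a commutative monoid, and $a\star b\leqslant c \iff b\leqslant a\to c$ for all $a,b,c\in A$; nothing is assumed about $0$. $\mathsf{RL}$ is the variety of all residuated lattices. The logic $\models_{\mathsf{RL}}^{\leqslant}$ is defined by: (1) for finite non-empty $\{\varphi_0,\dots,\varphi_{n-1}\}$, $\varphi_0,\dots,\varphi_{n-1}\models_{\mathsf{RL}}^{\leqslant}\psi$ iff for all $\mathbf A\in\mathsf{RL}$, all homomorphisms $v:\mathbf{Fm}\to\mathbf A$ and all $a\in A$, if $v(\varphi_i)\geqslant a$ for all $i<n$ then $v(\psi)\geqslant a$; (2) $\emptyset\models_{\mathsf{RL}}^{\leqslant}\psi$ iff $v(\psi)=1$ for all such $\mathbf A$ and $v$; (3) for infinite $\Gamma$, $\Gamma\models_{\mathsf{RL}}^{\leqslant}\psi$ iff $\varphi_0,\dots,\varphi_{n-1}\models_{\mathsf{RL}}^{\leqslant}\psi$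 for some $\varphi_0,\dots,\varphi_{n-1}\in\Gamma$. This logic has theorems (for instance $1$). A g-matrix is a pair $\langle\mathbf A,\mathcal C\rangle$ with $\mathbf A$ an algebra and $\mathcal C$ a family of subsets of $A$ closed under arbitrary intersections and containing $A$; its closure operator is $C(X)=\bigcap\{T\in\mathcal C:X\subseteq T\}$. For a logic $L$ with consequence relation $\vdash_L$, an $L$-filter of an algebra $\mathbf B$ is an $F\subseteq B$ such that whenever $\Gamma\vdash_L\varphi$ and $v:\mathbf{Fm}\to\mathbf B$ is a homomorphism with $v[\Gamma]\subseteq F$, then $v(\varphi)\in F$. A full g-model of $L$ is a g-matrix $\langle\mathbf A,\mathcal C\rangle$ such that $\mathcal C=\{h^{-1}[F]:F\text{ an }L\text{-filter of }\mathbf B\}$ for some algebra $\mathbf B$ and surjective homomorphism $h:\mathbf A\to\mathbf B$. A sequent $\Gamma\rhd\varphi$ is a pair of a finite, possibly empty set $\Gamma$ of formulas and a formula $\varphi$. The Gentzen system $\mathcal G_{\mathsf{RL}}$ has (for all formulas $\varphi,\psi,\xi$ and finite sets $\Gamma$) the structural axioms and rules: $\varphi\rhd\varphi$; weakening (from $\Gamma\rhd\varphi$ infer $\Gamma,\psi\rhd\varphi$); cut (from $\Gamma\rhd\varphi$ and $\Gamma,\varphi\rhd\psi$ infer $\Gamma\rhd\psi$); the axioms $\emptyset\rhd\varphi\to\varphi$; $\emptyset\rhd1$; $\varphi,\psi\rhd\varphi\wedge\psi$; $\varphi\wedge\psi\rhd\varphi$; $\varphi\wedge\psi\rhd\psi$;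 $\psi\to(\varphi\to\xi)\rhd\varphi\to(\psi\to\xi)$; and the rules: from $\emptyset\rhd\varphi\to\psi$ infer $\varphi\rhd\psi$; from $\varphi\vee\psi\rhd\xi$ infer $\varphi\rhd\xi$; from $\varphi\vee\psi\rhd\xi$ infer $\psi\rhd\xi$; from $\varphi\rhd\xi$ and $\psi\rhd\xi$ infer $\varphi\vee\psi\rhd\xi$; from $\varphi\star\psi\rhd\xi$ infer $\varphi\rhd\psi\to\xi$; from $\varphi\rhd\psi\to\xi$ infer $\varphi\star\psi\rhd\xi$. A g-matrix $\langle\mathbf A,\mathcal C\rangle$ with closure operator $C$ is a model of a rule with premises $\Gamma_i\rhd\varphi_i$ ($i<n$) and conclusion $\Gamma_n\rhd\varphi_n$ if for every homomorphism $v:\mathbf{Fm}\to\mathbf A$, $v(\varphi_i)\in C(v[\Gamma_i])$ for all $i<n$ implies $v(\varphi_n)\in C(v[\Gamma_n])$ (axioms are rules without premises). It is a model of a Gentzen system if it is a model of all its axioms and rules. A Gentzen system is called fully adequate for a logic that has theorems when the full g-models of the logic coincide with the models of the Gentzen system.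
   Formalization: The full g-models are shown to coincide with the finitary models of the Gentzen system (those with C(X) the union of C(Y) over finite subsets Y of X); without finitarity the claim fails, e.g. for principal filters on the reversed chain ω+1 with Gödel implication. *)

theory Defs
  imports "HOL-Algebra.Group" "HOL-Library.FSet" "HOL-Library.Countable_Set"
begin

text \<open>
  The monoid part of the signature (\<open>\<star>\<close>, \<open>1\<close>) is inherited from the record of monoids.
  The fields \<open>wedge\<close>, \<open>vee\<close>, \<open>imp\<close>, \<open>falsum\<close> interpret \<open>\<and>\<close>, \<open>\<or>\<close>, \<open>\<rightarrow>\<close>, \<open>0\<close>;
  the name \<open>falsum\<close> does not indicate that \<open>0\<close> is a least element.
\<close>

record 'a alg = "'a monoid" +
  wedge :: "'a \<Rightarrow> 'a \<Rightarrow> 'a"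
  vee :: "'a \<Rightarrow> 'a \<Rightarrow> 'a"
  imp :: "'a \<Rightarrow> 'a \<Rightarrow> 'a"
  falsum :: 'a

definition algebra :: "'a alg \<Rightarrow> bool" where
  "algebra A \<longleftrightarrow>
     (\<forall>a\<in>carrier A. \<forall>b\<in>carrier A.
        wedge A a b \<in> carrier A \<and> vee A a b \<in> carrier A \<and>
        a \<otimes>\<^bsub>A\<^esub> b \<in> carrier A \<and> imp A a b \<in> carrier A) \<and>
     \<one>\<^bsub>A\<^esub> \<in> carrier A \<and> falsum A \<in> carrier A"

definition alg_hom :: "'a alg \<Rightarrow> 'b alg \<Rightarrow> ('a \<Rightarrow> 'b) set" where
  "alg_hom A B = {h. h ` carrier A \<subseteq> carrier B \<and>
     (\<forall>a\<in>carrier A. \<forall>b\<in>carrier A.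
        h (wedge A a b) = wedge B (h a) (h b) \<and>
        h (vee A a b) = vee B (h a) (h b) \<and>
        h (a \<otimes>\<^bsub>A\<^esub> b) = h a \<otimes>\<^bsub>B\<^esub> h b \<and>
        h (imp A a b) = imp B (h a) (h b)) \<and>
     h \<one>\<^bsub>A\<^esub> = \<one>\<^bsub>B\<^esub> \<and> h (falsum A) = falsum B}"

definition alg_le :: "'a alg \<Rightarrow> 'a \<Rightarrow> 'a \<Rightarrow> bool" where
  "alg_le A a b \<longleftrightarrow> wedge A a b = a"

definition residuated_lattice :: "'a alg \<Rightarrow> bool" where
  "residuated_lattice A \<longleftrightarrow> algebra A \<and>
     (\<forall>a\<in>carrier A. \<forall>b\<in>carrier A.
        wedge A a b = wedge A b a \<and> vee A a b = vee A b a \<and>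
        wedge A a (vee A a b) = a \<and> vee A a (wedge A a b) = a) \<and>
     (\<forall>a\<in>carrier A. \<forall>b\<in>carrier A. \<forall>c\<in>carrier A.
        wedge A (wedge A a b) c = wedge A a (wedge A b c) \<and>
        vee A (vee A a b) c = vee A a (vee A b c)) \<and>
     (\<forall>a\<in>carrier A. alg_le A a \<one>\<^bsub>A\<^esub>) \<and>
     comm_monoid A \<and>
     (\<forall>a\<in>carrier A. \<forall>b\<in>carrier A. \<forall>c\<in>carrier A.
        alg_le A (a \<otimes>\<^bsub>A\<^esub> b) c \<longleftrightarrow> alg_le A b (imp A a c))"


datatype fm =
    Var nat
  | Conj fm fm (infixr "\<^bold>\<and>" 65)
  | Disj fm fm (infixr "\<^bold>\<or>" 64)
  | Fus fm fm (infixr "\<^bold>\<star>" 66)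
  | Impl fm fm (infixr "\<^bold>\<rightarrow>" 63)
  | One ("\<^bold>1")
  | Zero ("\<^bold>0")

instance fm :: countable
  by countable_datatype

definition Fm :: "fm alg" where
  "Fm = \<lparr>carrier = UNIV, mult = Fus, one = One,
         wedge = Conj, vee = Disj, imp = Impl, falsum = Zero\<rparr>"


type_synonym logic = "fm set \<Rightarrow> fm \<Rightarrow> bool"

text \<open>
  A definition cannot quantify over types, so the residuated lattices considered are those
  whose carrier is a subset of a type \<open>'u\<close>, passed as a type argument. As soon as \<open>'u\<close> is
  infinite the relation does not depend on it and covers residuated lattices over arbitrary
  types: see \<open>RL_conseq_transfer\<close> below.
\<close>

definition RL_conseq_fin :: "'u itself \<Rightarrow> logic" where
  "RL_conseq_fin U \<Gamma> \<psi> \<longleftrightarrow>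
     (if \<Gamma> = {}
      then \<forall>A :: 'u alg. residuated_lattice A \<longrightarrow> (\<forall>v\<in>alg_hom Fm A. v \<psi> = \<one>\<^bsub>A\<^esub>)
      else \<forall>A :: 'u alg. residuated_lattice A \<longrightarrow> (\<forall>v\<in>alg_hom Fm A. \<forall>a\<in>carrier A.
             (\<forall>\<phi>\<in>\<Gamma>. alg_le A a (v \<phi>)) \<longrightarrow> alg_le A a (v \<psi>)))"

definition RL_conseq :: "'u itself \<Rightarrow> logic" where
  "RL_conseq U \<Gamma> \<psi> \<longleftrightarrow>
     (if finite \<Gamma> then RL_conseq_fin U \<Gamma> \<psi>
      else \<exists>\<Delta>\<subseteq>\<Gamma>. finite \<Delta> \<and> RL_conseq_fin U \<Delta> \<psi>)"

definition has_theorems :: "logic \<Rightarrow> bool" where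
  "has_theorems L \<longleftrightarrow> (\<exists>\<phi>. L {} \<phi>)"

definition logic_filter :: "logic \<Rightarrow> 'b alg \<Rightarrow> 'b set \<Rightarrow> bool" where
  "logic_filter L B F \<longleftrightarrow> F \<subseteq> carrier B \<and>
     (\<forall>\<Gamma> \<phi>. L \<Gamma> \<phi> \<longrightarrow> (\<forall>v\<in>alg_hom Fm B. v ` \<Gamma> \<subseteq> F \<longrightarrow> v \<phi> \<in> F))"


definition gmatrix :: "'a alg \<Rightarrow> 'a set set \<Rightarrow> bool" where
  "gmatrix A \<C> \<longleftrightarrow> algebra A \<and> \<C> \<subseteq> Pow (carrier A) \<and> carrier A \<in> \<C> \<and>
     (\<forall>\<D>. \<D> \<subseteq> \<C> \<and> \<D> \<noteq> {} \<longrightarrow> \<Inter>\<D> \<in> \<C>)"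

definition gclosure :: "'a set set \<Rightarrow> 'a set \<Rightarrow> 'a set" where
  "gclosure \<C> X = \<Inter>{T \<in> \<C>. X \<subseteq> T}"

definition finitary_gmatrix :: "'a alg \<Rightarrow> 'a set set \<Rightarrow> bool" where
  "finitary_gmatrix A \<C> \<longleftrightarrow>
     (\<forall>X\<subseteq>carrier A. gclosure \<C> X = (\<Union>Y\<in>{Y. finite Y \<and> Y \<subseteq> X}. gclosure \<C> Y))"

text \<open>
  Taking the algebra \<open>B\<close> over the same type as \<open>A\<close> is no restriction, since a homomorphic
  image of \<open>A\<close> is isomorphic to an algebra on representatives in \<open>A\<close>: see
  \<open>full_gmodel_any_type\<close> below.
\<close>

definition full_gmodel :: "logic \<Rightarrow> 'a alg \<Rightarrow> 'a set set \<Rightarrow> bool" where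
  "full_gmodel L A \<C> \<longleftrightarrow> gmatrix A \<C> \<and>
     (\<exists>(B :: 'a alg) h. algebra B \<and> h \<in> alg_hom A B \<and> h ` carrier A = carrier B \<and>
        \<C> = {h -` F \<inter> carrier A | F. logic_filter L B F})"


datatype sequent = Sequent "fm fset" fm (infix "\<rhd>" 55)

type_synonym gentzen_system = "(sequent list \<times> sequent) set"

fun sequent_holds :: "'a set set \<Rightarrow> (fm \<Rightarrow> 'a) \<Rightarrow> sequent \<Rightarrow> bool" where
  "sequent_holds \<C> v (\<Gamma> \<rhd> \<phi>) \<longleftrightarrow> v \<phi> \<in> gclosure \<C> (v ` fset \<Gamma>)"

definition rule_model :: "'a alg \<Rightarrow> 'a set set \<Rightarrow> sequent list \<times> sequent \<Rightarrow> bool" where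
  "rule_model A \<C> r \<longleftrightarrow>
     (\<forall>v\<in>alg_hom Fm A. (\<forall>s\<in>set (fst r). sequent_holds \<C> v s) \<longrightarrow> sequent_holds \<C> v (snd r))"

definition gentzen_model :: "gentzen_system \<Rightarrow> 'a alg \<Rightarrow> 'a set set \<Rightarrow> bool" where
  "gentzen_model G A \<C> \<longleftrightarrow> gmatrix A \<C> \<and> (\<forall>r\<in>G. rule_model A \<C> r)"

text \<open>
  Only the finitary models of the Gentzen system are compared with the full g-models. Sequents
  have finite antecedents, so a g-matrix and its finitary companion are models of the same rules,
  whereas the full g-models of a finitary logic are finitary. For the system \<open>G_RL\<close> below the restriction is
  necessary: on the chain of extended naturals with reversed order and Goedel implication, the
  principal filters form a non-finitary g-matrix which is a model of all axioms and rules but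
  not a full g-model.
  The type argument is the universe of the algebras of the g-matrices.
\<close>

definition fully_adequate :: "'a itself \<Rightarrow> gentzen_system \<Rightarrow> logic \<Rightarrow> bool" where
  "fully_adequate U G L \<longleftrightarrow> has_theorems L \<and>
     (\<forall>(A :: 'a alg) \<C>. full_gmodel L A \<C> \<longleftrightarrow> gentzen_model G A \<C> \<and> finitary_gmatrix A \<C>)"

inductive_set G_RL :: gentzen_system where
  identity: "([], {|\<phi>|} \<rhd> \<phi>) \<in> G_RL"
| weakening: "([\<Gamma> \<rhd> \<phi>], finsert \<psi> \<Gamma> \<rhd> \<phi>) \<in> G_RL"
| cut: "([\<Gamma> \<rhd> \<phi>, finsert \<phi> \<Gamma> \<rhd> \<psi>], \<Gamma> \<rhd> \<psi>) \<in> G_RL"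
| imp_refl: "([], {||} \<rhd> \<phi> \<^bold>\<rightarrow> \<phi>) \<in> G_RL"
| unit: "([], {||} \<rhd> \<^bold>1) \<in> G_RL"
| wedge_I: "([], {|\<phi>, \<psi>|} \<rhd> \<phi> \<^bold>\<and> \<psi>) \<in> G_RL"
| wedge_E1: "([], {|\<phi> \<^bold>\<and> \<psi>|} \<rhd> \<phi>) \<in> G_RL"
| wedge_E2: "([], {|\<phi> \<^bold>\<and> \<psi>|} \<rhd> \<psi>) \<in> G_RL"
| exchange: "([], {|\<psi> \<^bold>\<rightarrow> (\<phi> \<^bold>\<rightarrow> \<xi>)|} \<rhd> \<phi> \<^bold>\<rightarrow> (\<psi> \<^bold>\<rightarrow> \<xi>)) \<in> G_RL"
| detachment: "([{||} \<rhd> \<phi> \<^bold>\<rightarrow> \<psi>], {|\<phi>|} \<rhd> \<psi>) \<in> G_RL"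
| vee_left: "([{|\<phi> \<^bold>\<or> \<psi>|} \<rhd> \<xi>], {|\<phi>|} \<rhd> \<xi>) \<in> G_RL"
| vee_right: "([{|\<phi> \<^bold>\<or> \<psi>|} \<rhd> \<xi>], {|\<psi>|} \<rhd> \<xi>) \<in> G_RL"
| vee_E: "([{|\<phi>|} \<rhd> \<xi>, {|\<psi>|} \<rhd> \<xi>], {|\<phi> \<^bold>\<or> \<psi>|} \<rhd> \<xi>) \<in> G_RL"
| residI: "([{|\<phi> \<^bold>\<star> \<psi>|} \<rhd> \<xi>], {|\<phi>|} \<rhd> \<psi> \<^bold>\<rightarrow> \<xi>) \<in> G_RL"
| residE: "([{|\<phi>|} \<rhd> \<psi> \<^bold>\<rightarrow> \<xi>], {|\<phi> \<^bold>\<star> \<psi>|} \<rhd> \<xi>) \<in> G_RL"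


definition transport :: "('a \<Rightarrow> 'b) \<Rightarrow> 'a alg \<Rightarrow> 'b alg" where
  "transport f A = (let g = inv_into (carrier A) f in
     \<lparr>carrier = f ` carrier A, mult = \<lambda>x y. f (g x \<otimes>\<^bsub>A\<^esub> g y), one = f \<one>\<^bsub>A\<^esub>,
      wedge = \<lambda>x y. f (wedge A (g x) (g y)), vee = \<lambda>x y. f (vee A (g x) (g y)),
      imp = \<lambda>x y. f (imp A (g x) (g y)), falsum = f (falsum A)\<rparr>)"

lemma transport_algebra:
  assumes "inj_on f (carrier A)" "algebra A"
  shows "algebra (transport f A)"
  using assms by (auto simp: algebra_def transport_def Let_def)

lemma transport_hom:
  assumes "inj_on f (carrier A)" "algebra A"
  shows "f \<in> alg_hom A (transport f A)"
  using assms by (auto simp: algebra_def alg_hom_def transport_def Let_def)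

lemma transport_hom_inv:
  assumes "inj_on f (carrier A)" "algebra A"
  shows "inv_into (carrier A) f \<in> alg_hom (transport f A) A"
  using assms by (auto simp: algebra_def alg_hom_def transport_def Let_def)

lemma transport_residuated_lattice:
  assumes i: "inj_on f (carrier A)" and r: "residuated_lattice A"
  shows "residuated_lattice (transport f A)"
proof -
  have a: "algebra A" using r by (simp add: residuated_lattice_def)
  then have cl: "wedge A x y \<in> carrier A" "vee A x y \<in> carrier A"
      "x \<otimes>\<^bsub>A\<^esub> y \<in> carrier A" "imp A x y \<in> carrier A" "\<one>\<^bsub>A\<^esub> \<in> carrier A"
    if "x \<in> carrier A" "y \<in> carrier A" for x y
    using that by (auto simp: algebra_def)
  have one: "\<one>\<^bsub>A\<^esub> \<in> carrier A" using a by (simp add: algebra_def)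
  have eq: "f x = f y \<longleftrightarrow> x = y" if "x \<in> carrier A" "y \<in> carrier A" for x y
    using i that by (auto dest: inj_onD)
  have cm: "comm_monoid A" using r by (simp add: residuated_lattice_def)
  interpret comm_monoid A by (fact cm)
  let ?T = "transport f A"
  have c: "carrier ?T = f ` carrier A" by (simp add: transport_def Let_def)
  have op: "wedge ?T (f x) (f y) = f (wedge A x y)" "vee ?T (f x) (f y) = f (vee A x y)"
      "f x \<otimes>\<^bsub>?T\<^esub> f y = f (x \<otimes>\<^bsub>A\<^esub> y)" "imp ?T (f x) (f y) = f (imp A x y)"
      "alg_le ?T (f x) (f y) \<longleftrightarrow> alg_le A x y"
    if "x \<in> carrier A" "y \<in> carrier A" for x y
    using that i by (simp_all add: transport_def Let_def alg_le_def eq cl)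
  have oT: "\<one>\<^bsub>?T\<^esub> = f \<one>\<^bsub>A\<^esub>" by (simp add: transport_def Let_def)
  have "comm_monoid ?T"
    by unfold_locales (auto simp: c op oT cl one m_ac)
  moreover have "\<forall>a\<in>carrier ?T. alg_le ?T a \<one>\<^bsub>?T\<^esub>"
    using r one by (auto simp: residuated_lattice_def c op oT)
  moreover have "wedge ?T a b = wedge ?T b a \<and> vee ?T a b = vee ?T b a \<and>
        wedge ?T a (vee ?T a b) = a \<and> vee ?T a (wedge ?T a b) = a"
    if ab: "a \<in> carrier ?T" "b \<in> carrier ?T" for a b
  proof -
    obtain x y where xy: "a = f x" "b = f y" "x \<in> carrier A" "y \<in> carrier A"
      using ab c by auto
    then have "wedge A x y = wedge A y x \<and> vee A x y = vee A y x \<and>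
        wedge A x (vee A x y) = x \<and> vee A x (wedge A x y) = x"
      using r by (simp only: residuated_lattice_def)
    then show ?thesis unfolding xy(1,2) using xy(3,4) op(1,2) cl(1,2) by metis
  qed
  moreover have "wedge ?T (wedge ?T a b) d = wedge ?T a (wedge ?T b d) \<and>
        vee ?T (vee ?T a b) d = vee ?T a (vee ?T b d) \<and>
        (alg_le ?T (a \<otimes>\<^bsub>?T\<^esub> b) d \<longleftrightarrow> alg_le ?T b (imp ?T a d))"
    if abd: "a \<in> carrier ?T" "b \<in> carrier ?T" "d \<in> carrier ?T" for a b d
  proof -
    obtain x y z where xyz: "a = f x" "b = f y" "d = f z"
        "x \<in> carrier A" "y \<in> carrier A" "z \<in> carrier A"
      using abd c by auto
    then have "wedge A (wedge A x y) z = wedge A x (wedge A y z) \<and>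
        vee A (vee A x y) z = vee A x (vee A y z) \<and>
        (alg_le A (x \<otimes>\<^bsub>A\<^esub> y) z \<longleftrightarrow> alg_le A y (imp A x z))"
      using r by (simp only: residuated_lattice_def)
    then show ?thesis using xyz(4-6) by (simp only: xyz(1-3) op cl)
  qed
  ultimately show ?thesis
    unfolding residuated_lattice_def using transport_algebra[OF i a] by blast
qed

lemma alg_hom_comp:
  "h \<in> alg_hom A B \<Longrightarrow> k \<in> alg_hom B D \<Longrightarrow> k \<circ> h \<in> alg_hom A D"
  by (auto simp: alg_hom_def image_subset_iff)

lemma logic_filter_transport:
  fixes B :: "'b alg" and f :: "'b \<Rightarrow> 'a"
  assumes i: "inj_on f (carrier B)" and a: "algebra B" and F: "F \<subseteq> carrier B"
  shows "logic_filter L (transport f B) (f ` F) \<longleftrightarrow> logic_filter L B F"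
proof -
  have c: "carrier (transport f B) = f ` carrier B" by (simp add: transport_def Let_def)
  let ?g = "inv_into (carrier B) f"
  have F': "f x \<in> f ` F \<longleftrightarrow> x \<in> F" if "x \<in> carrier B" for x
    using i F that by (auto dest: inj_onD)
  have G': "?g y \<in> F \<longleftrightarrow> y \<in> f ` F" if y: "y \<in> f ` carrier B" for y
  proof -
    obtain x where x: "x \<in> carrier B" "y = f x" using y by blast
    then show ?thesis using F'[OF x(1)] i by simp
  qed
  show ?thesis
  proof
    assume l: "logic_filter L (transport f B) (f ` F)"
    have "v \<phi> \<in> F" if "L \<Gamma> \<phi>" "v \<in> alg_hom Fm B" "v ` \<Gamma> \<subseteq> F" for \<Gamma> \<phi> v
    proof -
      have "f \<circ> v \<in> alg_hom Fm (transport f B)"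
        using that(2) transport_hom[OF i a] by (rule alg_hom_comp)
      moreover have "(f \<circ> v) ` \<Gamma> \<subseteq> f ` F" using that(3) by auto
      ultimately have "(f \<circ> v) \<phi> \<in> f ` F"
        using l that(1) unfolding logic_filter_def by blast
      moreover have "v \<phi> \<in> carrier B" using that(2) by (auto simp: alg_hom_def Fm_def)
      ultimately show ?thesis using F' by simp
    qed
    then show "logic_filter L B F" using F by (simp add: logic_filter_def)
  next
    assume l: "logic_filter L B F"
    have "w \<phi> \<in> f ` F" if "L \<Gamma> \<phi>" "w \<in> alg_hom Fm (transport f B)" "w ` \<Gamma> \<subseteq> f ` F" for \<Gamma> \<phi> w
    proof -
      have wc: "w \<psi> \<in> f ` carrier B" for \<psi>
        using that(2) by (auto simp: alg_hom_def Fm_def c)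
      have "?g \<circ> w \<in> alg_hom Fm B"
        using that(2) transport_hom_inv[OF i a] by (rule alg_hom_comp)
      moreover have "(?g \<circ> w) ` \<Gamma> \<subseteq> F"
        using that(3) G' wc unfolding image_subset_iff comp_def by blast
      ultimately have "(?g \<circ> w) \<phi> \<in> F"
        using l that(1) unfolding logic_filter_def by blast
      then show ?thesis using G' wc by simp
    qed
    then show "logic_filter L (transport f B) (f ` F)"
      using F by (auto simp: logic_filter_def c)
  qed
qed

lemma full_gmodel_any_type:
  fixes A :: "'a alg" and B :: "'b alg"
  assumes g: "gmatrix A \<C>" and B: "algebra B"
    and h: "h \<in> alg_hom A B" "h ` carrier A = carrier B"
    and C: "\<C> = {h -` F \<inter> carrier A | F. logic_filter L B F}"
  shows "full_gmodel L A \<C>"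
proof -
  define f where "f = inv_into (carrier A) h"
  have i: "inj_on f (carrier B)"
    unfolding f_def by (rule inj_on_inv_into) (simp add: h(2))
  have c: "carrier (transport f B) = f ` carrier B" by (simp add: transport_def Let_def)
  have s: "(f \<circ> h) ` carrier A = carrier (transport f B)"
    unfolding c h(2)[symmetric] by (simp add: image_comp)
  have hc: "h x \<in> carrier B" if "x \<in> carrier A" for x using h(2) that by auto
  have v: "(f \<circ> h) -` (f ` F) \<inter> carrier A = h -` F \<inter> carrier A" if "F \<subseteq> carrier B" for F
    unfolding vimage_def comp_def using inj_on_image_mem_iff[OF i hc that] by blast
  have sub: "F \<subseteq> carrier B" if "logic_filter L B F" for F
    using that by (simp add: logic_filter_def)
  have "\<C> = {(f \<circ> h) -` F \<inter> carrier A | F. logic_filter L (transport f B) F}" (is "_ = ?R")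
  proof (rule Set.set_eqI, rule iffI)
    fix T assume "T \<in> \<C>"
    then obtain F where F: "logic_filter L B F" "T = h -` F \<inter> carrier A" using C by auto
    then have "T = (f \<circ> h) -` (f ` F) \<inter> carrier A" using v sub by simp
    then show "T \<in> ?R" using F(1) logic_filter_transport[OF i B sub[OF F(1)]] by blast
  next
    fix T assume "T \<in> ?R"
    then obtain G where G: "logic_filter L (transport f B) G" "T = (f \<circ> h) -` G \<inter> carrier A"
      by auto
    then have "G \<subseteq> f ` carrier B" by (simp add: logic_filter_def c)
    then obtain F where F: "F \<subseteq> carrier B" "G = f ` F" by (auto simp: subset_image_iff)
    then have "logic_filter L B F" using G(1) logic_filter_transport[OF i B F(1)] by simp
    moreover have "T = h -` F \<inter> carrier A" using G(2) F v by simp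
    ultimately show "T \<in> \<C>" using C by auto
  qed
  then show ?thesis
    unfolding full_gmodel_def
    using g transport_algebra[OF i B] alg_hom_comp[OF h(1) transport_hom[OF i B]] s by blast
qed

lemma wedge_idem:
  assumes r: "residuated_lattice A" and x: "x \<in> carrier A"
  shows "wedge A x x = x"
proof -
  have w: "wedge A x x \<in> carrier A"
    using r x by (auto simp: residuated_lattice_def algebra_def)
  have "wedge A x (vee A x y) = x" "vee A x (wedge A x y) = x" if "y \<in> carrier A" for y
    using r x that by (auto simp: residuated_lattice_def)
  from this(1)[OF w] this(2)[OF x] show ?thesis by simp
qed

lemma finite_meet_formula:
  assumes "finite \<Gamma>" "\<Gamma> \<noteq> {}"
  shows "\<exists>\<gamma>. \<forall>A :: 'w alg. residuated_lattice A \<longrightarrow> (\<forall>v\<in>alg_hom Fm A. \<forall>a\<in>carrier A.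
           alg_le A a (v \<gamma>) \<longleftrightarrow> (\<forall>\<phi>\<in>\<Gamma>. alg_le A a (v \<phi>)))"
  using assms
proof (induction rule: finite_ne_induct)
  case (singleton \<phi>)
  show ?case by (rule exI[of _ \<phi>]) auto
next
  case (insert \<phi> \<Gamma>)
  then obtain \<gamma> where \<gamma>: "\<And>(A :: 'w alg) v a. residuated_lattice A \<Longrightarrow> v \<in> alg_hom Fm A \<Longrightarrow>
      a \<in> carrier A \<Longrightarrow> alg_le A a (v \<gamma>) \<longleftrightarrow> (\<forall>\<phi>\<in>\<Gamma>. alg_le A a (v \<phi>))"
    by blast
  have "alg_le A a (v (\<phi> \<^bold>\<and> \<gamma>)) \<longleftrightarrow> alg_le A a (v \<phi>) \<and> alg_le A a (v \<gamma>)"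
    if r: "residuated_lattice A" and v: "v \<in> alg_hom Fm A" and a: "a \<in> carrier A"
    for A :: "'w alg" and v a
  proof -
    have c: "v \<psi> \<in> carrier A" for \<psi> using v by (auto simp: alg_hom_def Fm_def)
    have w: "v (\<phi> \<^bold>\<and> \<gamma>) = wedge A (v \<phi>) (v \<gamma>)" using v by (simp add: alg_hom_def Fm_def)
    have cl: "wedge A x y \<in> carrier A" if "x \<in> carrier A" "y \<in> carrier A" for x y
      using r that by (auto simp: residuated_lattice_def algebra_def)
    have com: "wedge A x y = wedge A y x" if "x \<in> carrier A" "y \<in> carrier A" for x y
      using r that by (auto simp: residuated_lattice_def)
    have ass: "wedge A (wedge A x y) z = wedge A x (wedge A y z)"
      if "x \<in> carrier A" "y \<in> carrier A" "z \<in> carrier A" for x y z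
      using r that by (auto simp: residuated_lattice_def)
    have idem: "wedge A x x = x" if "x \<in> carrier A" for x
      using r that by (rule wedge_idem)
    show ?thesis unfolding alg_le_def w
      by (metis a c cl com ass idem)
  qed
  then show ?case using \<gamma> by (intro exI[of _ "\<phi> \<^bold>\<and> \<gamma>"]) auto
qed

lemma residuated_lattice_range:
  assumes r: "residuated_lattice A" and v: "v \<in> alg_hom Fm A"
  shows "residuated_lattice (A\<lparr>carrier := range v\<rparr>)"
proof -
  have v': "wedge A (v \<phi>) (v \<psi>) = v (\<phi> \<^bold>\<and> \<psi>)" "vee A (v \<phi>) (v \<psi>) = v (\<phi> \<^bold>\<or> \<psi>)"
    "v \<phi> \<otimes>\<^bsub>A\<^esub> v \<psi> = v (\<phi> \<^bold>\<star> \<psi>)" "imp A (v \<phi>) (v \<psi>) = v (\<phi> \<^bold>\<rightarrow> \<psi>)"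
    "\<one>\<^bsub>A\<^esub> = v \<^bold>1" "falsum A = v \<^bold>0" for \<phi> \<psi>
    using v by (simp_all add: alg_hom_def Fm_def)
  have c: "v \<psi> \<in> carrier A" for \<psi> using v by (auto simp: alg_hom_def Fm_def)
  then have sub: "range v \<subseteq> carrier A" by auto
  have alg: "algebra (A\<lparr>carrier := range v\<rparr>)"
    by (auto simp: algebra_def v')
  have cm: "comm_monoid A" using r by (simp add: residuated_lattice_def)
  interpret comm_monoid A by (fact cm)
  have "comm_monoid (A\<lparr>carrier := range v\<rparr>)"
  proof (unfold_locales, simp_all)
    show "\<one>\<^bsub>A\<^esub> \<in> range v" by (simp add: v')
    show "x \<otimes>\<^bsub>A\<^esub> y \<in> range v" if "x \<in> range v" "y \<in> range v" for x y
      using that by (auto simp: v')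
    show "x \<otimes>\<^bsub>A\<^esub> y \<otimes>\<^bsub>A\<^esub> z = x \<otimes>\<^bsub>A\<^esub> (y \<otimes>\<^bsub>A\<^esub> z)" if "x \<in> range v" "y \<in> range v" "z \<in> range v" for x y z
      using that sub m_assoc by blast
    show "x \<otimes>\<^bsub>A\<^esub> y = y \<otimes>\<^bsub>A\<^esub> x" if "x \<in> range v" "y \<in> range v" for x y
      using that sub m_comm by blast
    show "\<one>\<^bsub>A\<^esub> \<otimes>\<^bsub>A\<^esub> x = x" if "x \<in> range v" for x using that sub by auto
    show "x \<otimes>\<^bsub>A\<^esub> \<one>\<^bsub>A\<^esub> = x" if "x \<in> range v" for x using that sub by auto
  qed
  moreover have "alg_le (A\<lparr>carrier := range v\<rparr>) = alg_le A"
    by (simp add: alg_le_def fun_eq_iff)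
  ultimately show ?thesis
    using r alg sub unfolding residuated_lattice_def
    by (simp add: subset_iff del: image_iff)
qed

lemma RL_conseq_fin_transfer:
  assumes inf: "infinite (UNIV :: 'u set)" and "finite \<Gamma>"
    and L: "RL_conseq_fin TYPE('u) \<Gamma> \<psi>"
  shows "RL_conseq_fin TYPE('w) \<Gamma> \<psi>"
proof -
  have key: "\<exists>(D :: 'u alg) f. residuated_lattice D \<and> f \<circ> v \<in> alg_hom Fm D \<and>
      inj_on f (range v) \<and> carrier D = f ` range v \<and> \<one>\<^bsub>D\<^esub> = f \<one>\<^bsub>A\<^esub> \<and>
      (\<forall>\<phi> \<psi>. alg_le D (f (v \<phi>)) (f (v \<psi>)) \<longleftrightarrow> alg_le A (v \<phi>) (v \<psi>))"
    if r: "residuated_lattice A" and v: "v \<in> alg_hom Fm A" for A :: "'w alg" and v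
  proof -
    define S where "S = A\<lparr>carrier := range v\<rparr>"
    have rS: "residuated_lattice S" unfolding S_def using r v by (rule residuated_lattice_range)
    then have aS: "algebra S" by (simp add: residuated_lattice_def)
    have cS: "carrier S = range v" by (simp add: S_def)
    have "countable (range v)" by simp
    then obtain e :: "'w \<Rightarrow> nat" where e: "inj_on e (range v)" by (auto simp: countable_def)
    obtain k :: "nat \<Rightarrow> 'u" where k: "inj k"
      using infinite_countable_subset[OF inf] by blast
    define f where "f = k \<circ> e"
    have f: "inj_on f (carrier S)"
      unfolding f_def cS using e k by (meson comp_inj_on inj_on_subset subset_UNIV)
    have vS: "v \<in> alg_hom Fm S" using v by (auto simp: alg_hom_def S_def Fm_def)
    have sv: "wedge A (v \<phi>) (v \<psi>) \<in> range v" for \<phi> \<psi>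
      using aS by (auto simp: algebra_def S_def)
    have 1: "\<one>\<^bsub>A\<^esub> = v \<^bold>1" using v by (simp add: alg_hom_def Fm_def)
    let ?D = "transport f S"
    have "inv_into (range v) f (f (v \<phi>)) = v \<phi>" for \<phi>
      using f cS by (simp add: inv_into_f_f)
    then have "alg_le ?D (f (v \<phi>)) (f (v \<psi>)) \<longleftrightarrow> f (wedge A (v \<phi>) (v \<psi>)) = f (v \<phi>)" for \<phi> \<psi>
      by (simp add: alg_le_def transport_def Let_def S_def)
    then have "alg_le ?D (f (v \<phi>)) (f (v \<psi>)) \<longleftrightarrow> alg_le A (v \<phi>) (v \<psi>)" for \<phi> \<psi>
      using f cS sv by (auto simp: alg_le_def dest: inj_onD)
    moreover have "f \<circ> v \<in> alg_hom Fm ?D" using vS transport_hom[OF f aS] by (rule alg_hom_comp)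
    ultimately show ?thesis
      using transport_residuated_lattice[OF f rS] f cS
      by (intro exI[of _ ?D] exI[of _ f]) (auto simp: transport_def Let_def S_def)
  qed
  show ?thesis
  proof (cases "\<Gamma> = {}")
    case True
    have "v \<psi> = \<one>\<^bsub>A\<^esub>" if r: "residuated_lattice A" and v: "v \<in> alg_hom Fm A" for A :: "'w alg" and v
    proof -
      obtain D :: "'u alg" and f where D: "residuated_lattice D" "f \<circ> v \<in> alg_hom Fm D"
        "inj_on f (range v)" "\<one>\<^bsub>D\<^esub> = f \<one>\<^bsub>A\<^esub>"
        using key[OF r v] by blast
      have "(f \<circ> v) \<psi> = \<one>\<^bsub>D\<^esub>"
        using L D(1,2) unfolding RL_conseq_fin_def if_P[OF True] by blast
      moreover have "\<one>\<^bsub>A\<^esub> = v \<^bold>1" using v by (simp add: alg_hom_def Fm_def)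
      ultimately show ?thesis using D(3,4) by (auto dest: inj_onD)
    qed
    then show ?thesis by (simp add: RL_conseq_fin_def True)
  next
    case False
    obtain \<gamma> where \<gamma>: "\<And>(A :: 'w alg) v a. residuated_lattice A \<Longrightarrow> v \<in> alg_hom Fm A \<Longrightarrow>
        a \<in> carrier A \<Longrightarrow> alg_le A a (v \<gamma>) \<longleftrightarrow> (\<forall>\<phi>\<in>\<Gamma>. alg_le A a (v \<phi>))"
      using finite_meet_formula[OF assms(2) False, where 'w = 'w] by blast
    have "alg_le A a (v \<psi>)"
      if r: "residuated_lattice A" and v: "v \<in> alg_hom Fm A" and a: "a \<in> carrier A"
        and le: "\<forall>\<phi>\<in>\<Gamma>. alg_le A a (v \<phi>)" for A :: "'w alg" and v a
    proof -
      have c: "v \<phi> \<in> carrier A" for \<phi> using v by (auto simp: alg_hom_def Fm_def)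
      have cl: "wedge A x y \<in> carrier A" if "x \<in> carrier A" "y \<in> carrier A" for x y
        using r that by (auto simp: residuated_lattice_def algebra_def)
      have ass: "wedge A (wedge A x y) z = wedge A x (wedge A y z)"
        if "x \<in> carrier A" "y \<in> carrier A" "z \<in> carrier A" for x y z
        using r that by (auto simp: residuated_lattice_def)
      have idem: "wedge A x x = x" if "x \<in> carrier A" for x
        using r that by (rule wedge_idem)
      obtain D :: "'u alg" and f where D: "residuated_lattice D" "f \<circ> v \<in> alg_hom Fm D"
        "inj_on f (range v)" "carrier D = f ` range v"
        "\<And>\<phi> \<psi>. alg_le D (f (v \<phi>)) (f (v \<psi>)) \<longleftrightarrow> alg_le A (v \<phi>) (v \<psi>)"
        using key[OF r v] by blast
      have "alg_le A (v \<gamma>) (v \<gamma>)" using idem c by (simp add: alg_le_def)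
      then have "\<forall>\<phi>\<in>\<Gamma>. alg_le D (f (v \<gamma>)) ((f \<circ> v) \<phi>)"
        using \<gamma>[OF r v c] D(5) by simp
      moreover have "f (v \<gamma>) \<in> carrier D" using D(4) by simp
      ultimately have "alg_le D (f (v \<gamma>)) ((f \<circ> v) \<psi>)"
        using L D(1,2) unfolding RL_conseq_fin_def if_not_P[OF False] by blast
      then have "alg_le A (v \<gamma>) (v \<psi>)" using D(5) by simp
      moreover have "alg_le A a (v \<gamma>)" using \<gamma>[OF r v a] le by simp
      ultimately show ?thesis unfolding alg_le_def using ass a c by metis
    qed
    then show ?thesis using False by (simp add: RL_conseq_fin_def)
  qed
qed

lemma RL_conseq_transfer:
  assumes "infinite (UNIV :: 'u set)" and "RL_conseq TYPE('u) \<Gamma> \<psi>"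
  shows "RL_conseq TYPE('w) \<Gamma> \<psi>"
  using assms RL_conseq_fin_transfer[OF assms(1), where 'w = 'w]
  by (auto simp: RL_conseq_def split: if_splits)

end

theory Submission
  imports Defs
begin

text \<open>
  The filters of the logic on an algebra \<open>B\<close> are the subsets that contain \<open>1\<close> and are closed under
  \<open>\<and>\<close> and under the preorder generated by the pairs \<open>(v \<alpha>, v \<beta>)\<close> with \<open>\<alpha> \<Turnstile> \<beta>\<close>; this preorder makes
  \<open>B\<close> a residuated lattice up to equivalence, which yields the Gentzen rules for full g-models.
  Conversely, in a model of the Gentzen system the preorder \<open>b \<in> C {a}\<close> makes the algebra a
  residuated lattice up to equivalence, and by finitarity the closed sets are exactly the inverse
  images of the filters of the quotient.
\<close>

section \<open>Homomorphisms from the formula algebra\<close>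

text \<open>Both directions meet in the locale \<open>residuated_preorder\<close>, whose axioms
  restate the Gentzen rules for one-element antecedents, with \<open>1\<close> in place of an empty
  antecedent. It is instantiated by the order of a residuated lattice, by \<open>conseq_le\<close>
  on an arbitrary algebra, and by membership in the closure of one element. Neither the Gentzen
  system nor the locale has an axiom for commutativity, associativity or the unit of fusion: these
  come from exchange, detachment and residuation.

  The obstacle in the first direction is that \<open>B\<close> need not be a residuated lattice. A
  single entailment can be read off in \<open>B\<close> at once, but a rule with premises,
  residuation above all, starts from a chain of entailments whose homomorphisms differ. Chains are
  therefore pushed through each operation one step at a time, a spare variable carrying the other
  argument. The rules then follow from premise-free laws and this monotonicity.

  In the other direction the consequences are defined over \<open>'u\<close> while the quotient
  lives over the type of \<open>A\<close>; infinity of \<open>'u\<close> is what lets the former be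
  applied to the latter.\<close>

primrec fm_eval :: "'a alg \<Rightarrow> (nat \<Rightarrow> 'a) \<Rightarrow> fm \<Rightarrow> 'a" where
  "fm_eval A f (Var n) = f n"
| "fm_eval A f (\<phi> \<^bold>\<and> \<psi>) = wedge A (fm_eval A f \<phi>) (fm_eval A f \<psi>)"
| "fm_eval A f (\<phi> \<^bold>\<or> \<psi>) = vee A (fm_eval A f \<phi>) (fm_eval A f \<psi>)"
| "fm_eval A f (\<phi> \<^bold>\<star> \<psi>) = fm_eval A f \<phi> \<otimes>\<^bsub>A\<^esub> fm_eval A f \<psi>"
| "fm_eval A f (\<phi> \<^bold>\<rightarrow> \<psi>) = imp A (fm_eval A f \<phi>) (fm_eval A f \<psi>)"
| "fm_eval A f \<^bold>1 = \<one>\<^bsub>A\<^esub>"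
| "fm_eval A f \<^bold>0 = falsum A"

lemma fm_eval_hom:
  assumes A: "algebra A" and f: "\<And>n. f n \<in> carrier A"
  shows "fm_eval A f \<in> alg_hom Fm A"
proof -
  have "fm_eval A f \<phi> \<in> carrier A" for \<phi>
    using A by (induction \<phi>) (auto simp: f algebra_def)
  then show ?thesis by (auto simp: alg_hom_def Fm_def)
qed

lemma hom_Fm_simps:
  assumes "v \<in> alg_hom Fm A"
  shows "v (\<phi> \<^bold>\<and> \<psi>) = wedge A (v \<phi>) (v \<psi>)" "v (\<phi> \<^bold>\<or> \<psi>) = vee A (v \<phi>) (v \<psi>)"
    "v (\<phi> \<^bold>\<star> \<psi>) = v \<phi> \<otimes>\<^bsub>A\<^esub> v \<psi>" "v (\<phi> \<^bold>\<rightarrow> \<psi>) = imp A (v \<phi>) (v \<psi>)"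
    "v \<^bold>1 = \<one>\<^bsub>A\<^esub>" "v \<^bold>0 = falsum A" "v \<phi> \<in> carrier A"
  using assms by (auto simp: alg_hom_def Fm_def)

lemma hom_eq_fm_eval:
  assumes "v \<in> alg_hom Fm A"
  shows "v = fm_eval A (v \<circ> Var)"
proof
  show "v \<phi> = fm_eval A (v \<circ> Var) \<phi>" for \<phi>
    by (induction \<phi>) (simp_all add: hom_Fm_simps[OF assms])
qed

text \<open>The lattice and residuation laws and the logical rules involve at most three elements,
  so prescribing three variables suffices. All variables from \<open>Var 2\<close> on receive the
  default value \<open>c\<close>.\<close>

lemma hom_assigning:
  assumes "algebra A" "a \<in> carrier A" "b \<in> carrier A" "c \<in> carrier A"
  obtains v where "v \<in> alg_hom Fm A" "v (Var 0) = a" "v (Var 1) = b" "v (Var 2) = c"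
proof
  let ?f = "\<lambda>n::nat. if n = 0 then a else if n = 1 then b else c"
  show "fm_eval A ?f \<in> alg_hom Fm A" by (rule fm_eval_hom) (use assms in auto)
qed simp_all

lemma algebra_Fm: "algebra Fm"
  by (simp add: algebra_def Fm_def)

text \<open>Renames every variable to its successor, which frees \<open>Var 0\<close> for a
  parameter that a given homomorphism may fail to reach.\<close>

definition shift :: "fm \<Rightarrow> fm" where
  "shift = fm_eval Fm (Var \<circ> Suc)"

lemma shift_hom: "shift \<in> alg_hom Fm Fm"
  unfolding shift_def by (rule fm_eval_hom[OF algebra_Fm]) (simp add: Fm_def)

lemma fm_eval_shift: "fm_eval A (case_nat c f) (shift \<phi>) = fm_eval A f \<phi>"
  by (induction \<phi>) (simp_all add: shift_def Fm_def)

section \<open>Residuated preorders\<close>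

text \<open>Antisymmetry is left to the quotient. As in \<open>residI\<close> and
  \<open>residE\<close>, \<open>resid\<close> moves the right factor; \<open>exchange\<close> is the
  only axiom that lets two arguments trade places.\<close>

locale residuated_preorder =
  fixes A :: "'a alg" and le :: "'a \<Rightarrow> 'a \<Rightarrow> bool" (infix "\<preceq>" 50)
  assumes algebra: "algebra A"
    and refl: "a \<in> carrier A \<Longrightarrow> a \<preceq> a"
    and trans: "a \<in> carrier A \<Longrightarrow> b \<in> carrier A \<Longrightarrow> c \<in> carrier A \<Longrightarrow> a \<preceq> b \<Longrightarrow> b \<preceq> c \<Longrightarrow> a \<preceq> c"
    and wedge_le1: "a \<in> carrier A \<Longrightarrow> b \<in> carrier A \<Longrightarrow> wedge A a b \<preceq> a"
    and wedge_le2: "a \<in> carrier A \<Longrightarrow> b \<in> carrier A \<Longrightarrow> wedge A a b \<preceq> b"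
    and le_wedgeI: "a \<in> carrier A \<Longrightarrow> b \<in> carrier A \<Longrightarrow> c \<in> carrier A \<Longrightarrow>
      a \<preceq> b \<Longrightarrow> a \<preceq> c \<Longrightarrow> a \<preceq> wedge A b c"
    and vee_ge1: "a \<in> carrier A \<Longrightarrow> b \<in> carrier A \<Longrightarrow> a \<preceq> vee A a b"
    and vee_ge2: "a \<in> carrier A \<Longrightarrow> b \<in> carrier A \<Longrightarrow> b \<preceq> vee A a b"
    and vee_leI: "a \<in> carrier A \<Longrightarrow> b \<in> carrier A \<Longrightarrow> c \<in> carrier A \<Longrightarrow>
      a \<preceq> c \<Longrightarrow> b \<preceq> c \<Longrightarrow> vee A a b \<preceq> c"
    and le_one: "a \<in> carrier A \<Longrightarrow> a \<preceq> \<one>\<^bsub>A\<^esub>"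
    and one_le_imp_refl: "a \<in> carrier A \<Longrightarrow> \<one>\<^bsub>A\<^esub> \<preceq> imp A a a"
    and detach: "a \<in> carrier A \<Longrightarrow> b \<in> carrier A \<Longrightarrow> \<one>\<^bsub>A\<^esub> \<preceq> imp A a b \<Longrightarrow> a \<preceq> b"
    and exchange: "a \<in> carrier A \<Longrightarrow> b \<in> carrier A \<Longrightarrow> c \<in> carrier A \<Longrightarrow>
      imp A a (imp A b c) \<preceq> imp A b (imp A a c)"
    and resid: "a \<in> carrier A \<Longrightarrow> b \<in> carrier A \<Longrightarrow> c \<in> carrier A \<Longrightarrow>
      a \<otimes>\<^bsub>A\<^esub> b \<preceq> c \<longleftrightarrow> a \<preceq> imp A b c"
begin

section \<open>Arithmetic of residuated preorders\<close>

lemma closed [simp, intro]: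
  "a \<in> carrier A \<Longrightarrow> b \<in> carrier A \<Longrightarrow> wedge A a b \<in> carrier A"
  "a \<in> carrier A \<Longrightarrow> b \<in> carrier A \<Longrightarrow> vee A a b \<in> carrier A"
  "a \<in> carrier A \<Longrightarrow> b \<in> carrier A \<Longrightarrow> a \<otimes>\<^bsub>A\<^esub> b \<in> carrier A"
  "a \<in> carrier A \<Longrightarrow> b \<in> carrier A \<Longrightarrow> imp A a b \<in> carrier A"
  "\<one>\<^bsub>A\<^esub> \<in> carrier A" "falsum A \<in> carrier A"
  using algebra by (simp_all add: algebra_def)

lemma mult_imp_le: "a \<in> carrier A \<Longrightarrow> b \<in> carrier A \<Longrightarrow> imp A a b \<otimes>\<^bsub>A\<^esub> a \<preceq> b"
  by (simp add: resid refl)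

lemma le_imp_mult: "a \<in> carrier A \<Longrightarrow> b \<in> carrier A \<Longrightarrow> a \<preceq> imp A b (a \<otimes>\<^bsub>A\<^esub> b)"
  by (simp add: resid[symmetric] refl)

lemma wedge_mono:
  assumes "a \<in> carrier A" "b \<in> carrier A" "c \<in> carrier A" "d \<in> carrier A" "a \<preceq> b" "c \<preceq> d"
  shows "wedge A a c \<preceq> wedge A b d"
  by (intro le_wedgeI trans[OF _ _ _ wedge_le1 assms(5)] trans[OF _ _ _ wedge_le2 assms(6)])
    (simp_all add: assms)

lemma vee_mono:
  assumes "a \<in> carrier A" "b \<in> carrier A" "c \<in> carrier A" "d \<in> carrier A" "a \<preceq> b" "c \<preceq> d"
  shows "vee A a c \<preceq> vee A b d"
  by (intro vee_leI trans[OF _ _ _ assms(5) vee_ge1] trans[OF _ _ _ assms(6) vee_ge2])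
    (simp_all add: assms)

lemma mult_left_mono:
  assumes "a \<in> carrier A" "b \<in> carrier A" "c \<in> carrier A" "a \<preceq> b"
  shows "a \<otimes>\<^bsub>A\<^esub> c \<preceq> b \<otimes>\<^bsub>A\<^esub> c"
  using assms le_imp_mult[of b c] trans[of a b "imp A c (b \<otimes>\<^bsub>A\<^esub> c)"] by (simp add: resid)

lemma imp_right_mono:
  assumes "a \<in> carrier A" "b \<in> carrier A" "c \<in> carrier A" "a \<preceq> b"
  shows "imp A c a \<preceq> imp A c b"
  using assms mult_imp_le[of c a] trans[of "imp A c a \<otimes>\<^bsub>A\<^esub> c" a b] by (simp add: resid[symmetric])

lemma one_mult_le: "a \<in> carrier A \<Longrightarrow> \<one>\<^bsub>A\<^esub> \<otimes>\<^bsub>A\<^esub> a \<preceq> a"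
  by (simp add: resid one_le_imp_refl)

text \<open>Residuation gives \<open>1 \<preceq> a \<rightarrow> (1 \<star> a)\<close>, and
  detachment turns this into half of the unit law. The other half is \<open>one_le_imp_refl\<close>
  read through residuation.\<close>

lemma le_one_mult: "a \<in> carrier A \<Longrightarrow> a \<preceq> \<one>\<^bsub>A\<^esub> \<otimes>\<^bsub>A\<^esub> a"
  by (rule detach) (simp_all add: le_imp_mult)

lemma one_le_imp_iff:
  "a \<in> carrier A \<Longrightarrow> b \<in> carrier A \<Longrightarrow> \<one>\<^bsub>A\<^esub> \<preceq> imp A a b \<longleftrightarrow> a \<preceq> b"
  using detach[of a b] trans[OF _ _ _ one_mult_le, of a b] resid[of "\<one>\<^bsub>A\<^esub>" a b] closed by blast

text \<open>\<open>exchange\<close> compares two elements and says nothing about hypotheses. The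
  assumption is therefore internalised as
  \<open>1 \<preceq> a \<rightarrow> (b \<rightarrow> c)\<close>, exchanged there, and externalised
  again. This is the source of commutativity of fusion.\<close>

lemma le_imp_commute:
  assumes "a \<in> carrier A" "b \<in> carrier A" "c \<in> carrier A" "a \<preceq> imp A b c"
  shows "b \<preceq> imp A a c"
proof -
  have "\<one>\<^bsub>A\<^esub> \<preceq> imp A a (imp A b c)" using assms by (simp add: one_le_imp_iff)
  then have "\<one>\<^bsub>A\<^esub> \<preceq> imp A b (imp A a c)"
    using assms trans[OF _ _ _ _ exchange[of a b c]] by simp
  then show ?thesis using assms by (simp add: one_le_imp_iff)
qed

lemma mult_commute_le:
  assumes "a \<in> carrier A" "b \<in> carrier A"
  shows "a \<otimes>\<^bsub>A\<^esub> b \<preceq> b \<otimes>\<^bsub>A\<^esub> a"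
  using assms le_imp_commute[of b a "b \<otimes>\<^bsub>A\<^esub> a"] by (simp add: resid le_imp_mult)

lemma mult_le_commute:
  assumes "a \<in> carrier A" "b \<in> carrier A" "c \<in> carrier A"
  shows "a \<otimes>\<^bsub>A\<^esub> b \<preceq> c \<longleftrightarrow> b \<otimes>\<^bsub>A\<^esub> a \<preceq> c"
  unfolding resid[OF assms] resid[OF assms(2,1,3)]
  using le_imp_commute assms by blast

lemma mult_right_mono:
  assumes "a \<in> carrier A" "b \<in> carrier A" "c \<in> carrier A" "a \<preceq> b"
  shows "c \<otimes>\<^bsub>A\<^esub> a \<preceq> c \<otimes>\<^bsub>A\<^esub> b"
  using assms mult_left_mono[of a b c] mult_commute_le[of b c]
    trans[of "a \<otimes>\<^bsub>A\<^esub> c" "b \<otimes>\<^bsub>A\<^esub> c" "c \<otimes>\<^bsub>A\<^esub> b"]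
  by (simp add: mult_le_commute[of c a])

lemma imp_left_antimono:
  assumes "a \<in> carrier A" "b \<in> carrier A" "c \<in> carrier A" "a \<preceq> b"
  shows "imp A b c \<preceq> imp A a c"
  using assms mult_right_mono[of a b "imp A b c"] mult_imp_le[of b c]
    trans[of "imp A b c \<otimes>\<^bsub>A\<^esub> a" "imp A b c \<otimes>\<^bsub>A\<^esub> b" c]
  by (simp add: resid[symmetric])

lemma mult_mono:
  assumes "a \<in> carrier A" "b \<in> carrier A" "c \<in> carrier A" "d \<in> carrier A" "a \<preceq> b" "c \<preceq> d"
  shows "a \<otimes>\<^bsub>A\<^esub> c \<preceq> b \<otimes>\<^bsub>A\<^esub> d"
  by (rule trans[OF _ _ _ mult_left_mono[of a b c] mult_right_mono[of c d b]]) (simp_all add: assms)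

lemma imp_mono:
  assumes "a \<in> carrier A" "b \<in> carrier A" "c \<in> carrier A" "d \<in> carrier A" "b \<preceq> a" "c \<preceq> d"
  shows "imp A a c \<preceq> imp A b d"
  by (rule trans[OF _ _ _ imp_left_antimono[of b a c] imp_right_mono[of c d b]]) (simp_all add: assms)

text \<open>Associativity in the form "both products have the same upper bounds": residuation moves
  the factors into nested implications, where \<open>exchange\<close> can permute them. Choosing
  \<open>d\<close> as either product later gives the two inequalities.\<close>

lemma mult_assoc_le_iff:
  assumes "a \<in> carrier A" "b \<in> carrier A" "c \<in> carrier A" "d \<in> carrier A"
  shows "(a \<otimes>\<^bsub>A\<^esub> b) \<otimes>\<^bsub>A\<^esub> c \<preceq> d \<longleftrightarrow> a \<otimes>\<^bsub>A\<^esub> (b \<otimes>\<^bsub>A\<^esub> c) \<preceq> d"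
proof -
  have "(a \<otimes>\<^bsub>A\<^esub> b) \<otimes>\<^bsub>A\<^esub> c \<preceq> d \<longleftrightarrow> a \<otimes>\<^bsub>A\<^esub> b \<preceq> imp A c d"
    using assms by (simp add: resid)
  also have "\<dots> \<longleftrightarrow> b \<preceq> imp A a (imp A c d)"
    unfolding resid[OF assms(1,2) closed(4)[OF assms(3,4)]] using assms le_imp_commute by blast
  also have "\<dots> \<longleftrightarrow> b \<preceq> imp A c (imp A a d)"
    using assms exchange[of a c d] exchange[of c a d]
      trans[of b "imp A a (imp A c d)" "imp A c (imp A a d)"]
      trans[of b "imp A c (imp A a d)" "imp A a (imp A c d)"] closed by blast
  also have "\<dots> \<longleftrightarrow> (b \<otimes>\<^bsub>A\<^esub> c) \<otimes>\<^bsub>A\<^esub> a \<preceq> d"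
    using assms by (simp add: resid)
  also have "\<dots> \<longleftrightarrow> a \<otimes>\<^bsub>A\<^esub> (b \<otimes>\<^bsub>A\<^esub> c) \<preceq> d"
    using assms by (simp add: mult_le_commute)
  finally show ?thesis .
qed

section \<open>The quotient by the equivalence of a residuated preorder\<close>

definition rep :: "'a \<Rightarrow> 'a" where
  "rep a = (SOME b. b \<in> carrier A \<and> a \<preceq> b \<and> b \<preceq> a)"

lemma rep:
  assumes "a \<in> carrier A"
  shows "rep a \<in> carrier A" "a \<preceq> rep a" "rep a \<preceq> a"
proof -
  have "rep a \<in> carrier A \<and> a \<preceq> rep a \<and> rep a \<preceq> a"
    unfolding rep_def by (rule someI[of _ a]) (use assms refl in auto)
  then show "rep a \<in> carrier A" "a \<preceq> rep a" "rep a \<preceq> a" by auto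
qed

text \<open>Equivalent elements define the same predicate under \<open>SOME\<close>, hence receive
  the very same representative. This is why a choice function can replace equivalence
  classes.\<close>

lemma rep_eq_iff:
  assumes "a \<in> carrier A" "b \<in> carrier A"
  shows "rep a = rep b \<longleftrightarrow> a \<preceq> b \<and> b \<preceq> a"
proof
  assume "rep a = rep b"
  then show "a \<preceq> b \<and> b \<preceq> a"
    using rep[OF assms(1)] rep[OF assms(2)] trans[of a "rep a" b] trans[of b "rep b" a] assms
    by simp
next
  assume "a \<preceq> b \<and> b \<preceq> a"
  then have "c \<in> carrier A \<and> a \<preceq> c \<and> c \<preceq> a \<longleftrightarrow> c \<in> carrier A \<and> b \<preceq> c \<and> c \<preceq> b" for c
    using assms trans by blast
  then show "rep a = rep b" by (simp add: rep_def)
qed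

text \<open>Built on representatives rather than on classes, so that it is an algebra over the type
  \<open>'a\<close> itself, as \<open>full_gmodel\<close> demands of the target of its
  homomorphism.\<close>

definition quot :: "'a alg" where
  "quot = \<lparr>carrier = rep ` carrier A, mult = \<lambda>x y. rep (x \<otimes>\<^bsub>A\<^esub> y), one = rep \<one>\<^bsub>A\<^esub>,
     wedge = \<lambda>x y. rep (wedge A x y), vee = \<lambda>x y. rep (vee A x y),
     imp = \<lambda>x y. rep (imp A x y), falsum = rep (falsum A)\<rparr>"

text \<open>The equivalence is a congruence because meet, join and fusion are monotone in both
  arguments, while implication is antitone in the first and monotone in the second.\<close>

lemma quot_simps:
  assumes "a \<in> carrier A" "b \<in> carrier A"
  shows "wedge quot (rep a) (rep b) = rep (wedge A a b)"
    "vee quot (rep a) (rep b) = rep (vee A a b)"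
    "rep a \<otimes>\<^bsub>quot\<^esub> rep b = rep (a \<otimes>\<^bsub>A\<^esub> b)"
    "imp quot (rep a) (rep b) = rep (imp A a b)"
proof -
  have m: "rep a \<otimes>\<^bsub>A\<^esub> rep b \<preceq> a \<otimes>\<^bsub>A\<^esub> b" "a \<otimes>\<^bsub>A\<^esub> b \<preceq> rep a \<otimes>\<^bsub>A\<^esub> rep b"
    by (rule mult_mono; simp add: assms rep)+
  have i: "imp A (rep a) (rep b) \<preceq> imp A a b" "imp A a b \<preceq> imp A (rep a) (rep b)"
    by (rule imp_mono; simp add: assms rep)+
  show "wedge quot (rep a) (rep b) = rep (wedge A a b)"
    "vee quot (rep a) (rep b) = rep (vee A a b)"
    "rep a \<otimes>\<^bsub>quot\<^esub> rep b = rep (a \<otimes>\<^bsub>A\<^esub> b)"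
    "imp quot (rep a) (rep b) = rep (imp A a b)"
    using assms m i by (simp_all add: quot_def rep_eq_iff rep wedge_mono vee_mono)
qed

lemma quot_one: "\<one>\<^bsub>quot\<^esub> = rep \<one>\<^bsub>A\<^esub>" and quot_falsum: "falsum quot = rep (falsum A)"
  and quot_carrier: "carrier quot = rep ` carrier A"
  by (simp_all add: quot_def)

lemma quot_le:
  assumes "a \<in> carrier A" "b \<in> carrier A"
  shows "alg_le quot (rep a) (rep b) \<longleftrightarrow> a \<preceq> b"
  unfolding alg_le_def
  using assms wedge_le1[of a b] wedge_le2[of a b] le_wedgeI[of a a b] refl[of a]
    trans[of a "wedge A a b" b]
  by (auto simp: quot_simps rep_eq_iff)

lemma algebra_quot: "algebra quot"
  by (auto simp: algebra_def quot_carrier quot_simps quot_one quot_falsum)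

lemma rep_hom: "rep \<in> alg_hom A quot"
  by (simp add: alg_hom_def quot_carrier quot_simps quot_one quot_falsum)

lemma residuated_lattice_quot: "residuated_lattice quot"
proof -
  have "comm_monoid quot"
  proof
    fix x y z assume "x \<in> carrier quot" "y \<in> carrier quot" "z \<in> carrier quot"
    then obtain a b c where abc: "x = rep a" "y = rep b" "z = rep c"
      "a \<in> carrier A" "b \<in> carrier A" "c \<in> carrier A" by (auto simp: quot_carrier)
    \<comment> \<open>The two products have the same upper bounds; taking each of them as the bound
      gives both inequalities, hence equal representatives.\<close>
    show "(x \<otimes>\<^bsub>quot\<^esub> y) \<otimes>\<^bsub>quot\<^esub> z = x \<otimes>\<^bsub>quot\<^esub> (y \<otimes>\<^bsub>quot\<^esub> z)"
      using abc(4-) mult_assoc_le_iff[OF abc(4-6), of "a \<otimes>\<^bsub>A\<^esub> (b \<otimes>\<^bsub>A\<^esub> c)"]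
        mult_assoc_le_iff[OF abc(4-6), of "(a \<otimes>\<^bsub>A\<^esub> b) \<otimes>\<^bsub>A\<^esub> c"]
      by (simp add: abc(1-3) quot_simps rep_eq_iff refl)
  next
    fix x y assume "x \<in> carrier quot" "y \<in> carrier quot"
    then obtain a b where ab: "x = rep a" "y = rep b" "a \<in> carrier A" "b \<in> carrier A"
      by (auto simp: quot_carrier)
    show "x \<otimes>\<^bsub>quot\<^esub> y \<in> carrier quot" using ab by (simp add: quot_carrier quot_simps)
    show "x \<otimes>\<^bsub>quot\<^esub> y = y \<otimes>\<^bsub>quot\<^esub> x"
      using ab mult_commute_le by (simp add: quot_simps rep_eq_iff)
  next
    show "\<one>\<^bsub>quot\<^esub> \<in> carrier quot" by (simp add: quot_carrier quot_one)
  next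
    fix x assume "x \<in> carrier quot"
    then obtain a where a: "x = rep a" "a \<in> carrier A" by (auto simp: quot_carrier)
    have "\<one>\<^bsub>A\<^esub> \<otimes>\<^bsub>A\<^esub> a \<preceq> a" "a \<preceq> \<one>\<^bsub>A\<^esub> \<otimes>\<^bsub>A\<^esub> a" "a \<otimes>\<^bsub>A\<^esub> \<one>\<^bsub>A\<^esub> \<preceq> a" "a \<preceq> a \<otimes>\<^bsub>A\<^esub> \<one>\<^bsub>A\<^esub>"
      using a(2) one_mult_le le_one_mult mult_le_commute[of a "\<one>\<^bsub>A\<^esub>" a] closed(5)
        trans[OF _ _ _ le_one_mult mult_commute_le, of a] by blast+
    then show "\<one>\<^bsub>quot\<^esub> \<otimes>\<^bsub>quot\<^esub> x = x" "x \<otimes>\<^bsub>quot\<^esub> \<one>\<^bsub>quot\<^esub> = x"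
      using a by (simp_all add: quot_one quot_simps rep_eq_iff)
  qed
  moreover have "wedge quot x y = wedge quot y x \<and> vee quot x y = vee quot y x \<and>
      wedge quot x (vee quot x y) = x \<and> vee quot x (wedge quot x y) = x"
    if xy: "x \<in> carrier quot" "y \<in> carrier quot" for x y
  proof -
    obtain a b where ab: "x = rep a" "y = rep b" "a \<in> carrier A" "b \<in> carrier A"
      using xy by (auto simp: quot_carrier)
    show ?thesis
      using ab by (simp add: quot_simps rep_eq_iff le_wedgeI vee_leI wedge_le1 wedge_le2
          vee_ge1 vee_ge2 refl)
  qed
  moreover have "wedge quot (wedge quot x y) z = wedge quot x (wedge quot y z) \<and>
      vee quot (vee quot x y) z = vee quot x (vee quot y z) \<and>
      (alg_le quot (x \<otimes>\<^bsub>quot\<^esub> y) z \<longleftrightarrow> alg_le quot y (imp quot x z))"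
    if xyz: "x \<in> carrier quot" "y \<in> carrier quot" "z \<in> carrier quot" for x y z
  proof -
    obtain a b c where abc: "x = rep a" "y = rep b" "z = rep c"
      "a \<in> carrier A" "b \<in> carrier A" "c \<in> carrier A"
      using xyz by (auto simp: quot_carrier)
    have w: "wedge A (wedge A a b) c \<preceq> a" "wedge A (wedge A a b) c \<preceq> b"
      "wedge A a (wedge A b c) \<preceq> b" "wedge A a (wedge A b c) \<preceq> c"
      by (rule trans[OF _ _ _ wedge_le1 wedge_le1] trans[OF _ _ _ wedge_le1 wedge_le2]
          trans[OF _ _ _ wedge_le2 wedge_le1] trans[OF _ _ _ wedge_le2 wedge_le2];
          simp add: abc)+
    have v: "a \<preceq> vee A (vee A a b) c" "b \<preceq> vee A (vee A a b) c"
      "b \<preceq> vee A a (vee A b c)" "c \<preceq> vee A a (vee A b c)"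
      by (rule trans[OF _ _ _ vee_ge1 vee_ge1] trans[OF _ _ _ vee_ge2 vee_ge1]
          trans[OF _ _ _ vee_ge1 vee_ge2] trans[OF _ _ _ vee_ge2 vee_ge2];
          simp add: abc)+
    show ?thesis
      using abc(4-) w v mult_le_commute[of a b c] resid[of b a c]
      by (simp add: abc(1-3) quot_simps quot_le rep_eq_iff le_wedgeI vee_leI wedge_le1 wedge_le2
          vee_ge1 vee_ge2)
  qed
  ultimately show ?thesis
    unfolding residuated_lattice_def using algebra_quot
    by (auto simp: quot_carrier quot_one quot_le le_one)
qed

end

text \<open>Makes the laws derived in the locale available inside genuine residuated lattices, where
  the entailments of the logic have to be checked.\<close>

lemma residuated_preorder_alg_le:
  assumes r: "residuated_lattice A"
  shows "residuated_preorder A (alg_le A)"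
proof -
  have alg: "algebra A" using r by (simp add: residuated_lattice_def)
  have cl [simp]: "wedge A a b \<in> carrier A" "vee A a b \<in> carrier A"
      "a \<otimes>\<^bsub>A\<^esub> b \<in> carrier A" "imp A a b \<in> carrier A"
    if "a \<in> carrier A" "b \<in> carrier A" for a b
    using that alg by (auto simp: algebra_def)
  have one [simp]: "\<one>\<^bsub>A\<^esub> \<in> carrier A" using alg by (simp add: algebra_def)
  have com: "wedge A a b = wedge A b a" "vee A a b = vee A b a"
    and absorb: "wedge A a (vee A a b) = a" "vee A a (wedge A a b) = a"
    if "a \<in> carrier A" "b \<in> carrier A" for a b
    using r that by (simp_all add: residuated_lattice_def)
  have assoc: "wedge A (wedge A a b) c = wedge A a (wedge A b c)"
      "vee A (vee A a b) c = vee A a (vee A b c)"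
    if "a \<in> carrier A" "b \<in> carrier A" "c \<in> carrier A" for a b c
    using r that unfolding residuated_lattice_def by blast+
  have idem: "wedge A a a = a" if "a \<in> carrier A" for a using r that by (rule wedge_idem)
  have cm: "comm_monoid A" using r by (simp add: residuated_lattice_def)
  interpret comm_monoid A by (fact cm)
  \<comment> \<open>The definition of \<open>residuated_lattice\<close> moves the left factor, the
    locale the right one; commutativity reconciles them.\<close>
  have res: "alg_le A (a \<otimes>\<^bsub>A\<^esub> b) c \<longleftrightarrow> alg_le A a (imp A b c)"
    if "a \<in> carrier A" "b \<in> carrier A" "c \<in> carrier A" for a b c
    using r that m_comm[of a b] by (simp add: residuated_lattice_def)
  have top: "alg_le A a \<one>\<^bsub>A\<^esub>" if "a \<in> carrier A" for a
    using r that by (simp add: residuated_lattice_def)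
  have refl: "alg_le A a a" if "a \<in> carrier A" for a using that idem by (simp add: alg_le_def)
  have trans: "alg_le A a c"
    if "a \<in> carrier A" "b \<in> carrier A" "c \<in> carrier A" "alg_le A a b" "alg_le A b c" for a b c
    using that assoc unfolding alg_le_def by metis
  have le_vee: "alg_le A a b \<longleftrightarrow> vee A a b = b" if "a \<in> carrier A" "b \<in> carrier A" for a b
    using that com absorb unfolding alg_le_def by metis
  have mono: "alg_le A (a \<otimes>\<^bsub>A\<^esub> c) (b \<otimes>\<^bsub>A\<^esub> c)"
    if "a \<in> carrier A" "b \<in> carrier A" "c \<in> carrier A" "alg_le A a b" for a b c
    using that trans[of a b "imp A c (b \<otimes>\<^bsub>A\<^esub> c)"] by (simp add: res[symmetric] refl)
  show ?thesis
  proof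
    fix a b c assume abc: "a \<in> carrier A" "b \<in> carrier A" "c \<in> carrier A"
    show "alg_le A a b \<Longrightarrow> alg_le A b c \<Longrightarrow> alg_le A a c" using abc by (rule trans)
    show "alg_le A a b \<Longrightarrow> alg_le A a c \<Longrightarrow> alg_le A a (wedge A b c)"
      using abc assoc unfolding alg_le_def by metis
    show "alg_le A a c \<Longrightarrow> alg_le A b c \<Longrightarrow> alg_le A (vee A a b) c"
      using abc assoc by (simp add: le_vee)
    show "alg_le A (a \<otimes>\<^bsub>A\<^esub> b) c = alg_le A a (imp A b c)" using abc by (rule res)
    let ?i = "imp A a (imp A b c)"
    have "alg_le A (?i \<otimes>\<^bsub>A\<^esub> a) (imp A b c)" using abc by (simp add: res refl)
    then have "alg_le A ((?i \<otimes>\<^bsub>A\<^esub> a) \<otimes>\<^bsub>A\<^esub> b) c" using abc by (simp add: res)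
    then have "alg_le A ((?i \<otimes>\<^bsub>A\<^esub> b) \<otimes>\<^bsub>A\<^esub> a) c" using abc by (simp add: m_ac)
    then show "alg_le A ?i (imp A b (imp A a c))" using abc by (simp add: res)
  next
    fix a b assume ab: "a \<in> carrier A" "b \<in> carrier A"
    show "alg_le A (wedge A a b) a" "alg_le A (wedge A a b) b"
      using ab assoc idem com unfolding alg_le_def by metis+
    show "alg_le A a (vee A a b)" "alg_le A b (vee A a b)"
      using ab absorb com unfolding alg_le_def by metis+
    show "alg_le A \<one>\<^bsub>A\<^esub> (imp A a b) \<Longrightarrow> alg_le A a b" using ab by (simp add: res[symmetric])
  next
    fix a assume a: "a \<in> carrier A"
    show "alg_le A \<one>\<^bsub>A\<^esub> (imp A a a)" using a by (simp add: res[symmetric] refl)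
  qed (use alg refl top in auto)
qed

section \<open>Consequence and filters\<close>

text \<open>The bound \<open>a\<close> of the definition can be taken to be the value of the premise
  itself, so a single premise yields a plain inequality.\<close>

lemma RL_conseq_singleton:
  "RL_conseq TYPE('u) {\<alpha>} \<beta> \<longleftrightarrow>
     (\<forall>A :: 'u alg. residuated_lattice A \<longrightarrow> (\<forall>v\<in>alg_hom Fm A. alg_le A (v \<alpha>) (v \<beta>)))"
proof -
  have "(\<forall>a\<in>carrier A. alg_le A a (v \<alpha>) \<longrightarrow> alg_le A a (v \<beta>)) \<longleftrightarrow> alg_le A (v \<alpha>) (v \<beta>)"
    if r: "residuated_lattice A" and v: "v \<in> alg_hom Fm A" for A :: "'u alg" and v
  proof -
    interpret residuated_preorder A "alg_le A" using r by (rule residuated_preorder_alg_le)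
    have c: "v \<phi> \<in> carrier A" for \<phi> using v by (rule hom_Fm_simps)
    show ?thesis using refl[OF c[of \<alpha>]] trans[OF _ c c, of _ \<alpha> \<beta>] c[of \<alpha>] by blast
  qed
  then show ?thesis by (auto simp: RL_conseq_def RL_conseq_fin_def)
qed

lemma RL_conseq_singletonI:
  assumes "\<And>(A :: 'u alg) v. residuated_preorder A (alg_le A) \<Longrightarrow> v \<in> alg_hom Fm A \<Longrightarrow>
    alg_le A (v \<alpha>) (v \<beta>)"
  shows "RL_conseq TYPE('u) {\<alpha>} \<beta>"
  using assms residuated_preorder_alg_le by (auto simp: RL_conseq_singleton)

lemma RL_conseq_singletonD:
  fixes A :: "'u alg"
  assumes "RL_conseq TYPE('u) {\<alpha>} \<beta>" "residuated_lattice A" "v \<in> alg_hom Fm A"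
  shows "alg_le A (v \<alpha>) (v \<beta>)"
  using assms by (simp add: RL_conseq_singleton)

text \<open>The list ends in \<open>1\<close>, the empty meet, so that consequence from no premises
  becomes consequence from one premise.\<close>

definition conj_list :: "fm list \<Rightarrow> fm" where
  "conj_list \<phi>s = foldr Conj \<phi>s \<^bold>1"

lemma RL_conseq_conj_list: "RL_conseq TYPE('u) (set \<phi>s) \<psi> \<longleftrightarrow> RL_conseq TYPE('u) {conj_list \<phi>s} \<psi>"
proof -
  have meet: "alg_le A a (v (conj_list \<phi>s)) \<longleftrightarrow> (\<forall>\<phi>\<in>set \<phi>s. alg_le A a (v \<phi>))"
    if r: "residuated_lattice A" and v: "v \<in> alg_hom Fm A" and a: "a \<in> carrier A"
    for A :: "'u alg" and v a
  proof -
    interpret residuated_preorder A "alg_le A" using r by (rule residuated_preorder_alg_le)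
    have c: "v \<phi> \<in> carrier A" for \<phi> using v by (rule hom_Fm_simps)
    show ?thesis
    proof (induction \<phi>s)
      case Nil
      then show ?case using a by (simp add: conj_list_def hom_Fm_simps[OF v] le_one)
    next
      case (Cons \<phi> \<phi>s)
      have "alg_le A a (wedge A (v \<phi>) (v (conj_list \<phi>s))) \<longleftrightarrow>
          alg_le A a (v \<phi>) \<and> alg_le A a (v (conj_list \<phi>s))"
        using le_wedgeI[OF a c c] trans[OF a _ c _ wedge_le1[OF c c]]
          trans[OF a _ c _ wedge_le2[OF c c]] closed(1)[OF c c] by blast
      then show ?case using Cons by (simp add: conj_list_def hom_Fm_simps[OF v])
    qed
  qed
  \<comment> \<open>The clause for no premises demands the value \<open>1\<close>; as
    \<open>1\<close> is the maximum, this is the inequality needed for the premise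
    \<open>1\<close>.\<close>
  have one: "v \<psi> = \<one>\<^bsub>A\<^esub> \<longleftrightarrow> alg_le A \<one>\<^bsub>A\<^esub> (v \<psi>)"
    if r: "residuated_lattice A" and v: "v \<in> alg_hom Fm A" for A :: "'u alg" and v
  proof -
    interpret residuated_preorder A "alg_le A" using r by (rule residuated_preorder_alg_le)
    have "wedge A \<one>\<^bsub>A\<^esub> (v \<psi>) = wedge A (v \<psi>) \<one>\<^bsub>A\<^esub>"
      using r hom_Fm_simps(7)[OF v] by (simp add: residuated_lattice_def)
    then show ?thesis
      using le_one[of "v \<psi>"] refl hom_Fm_simps(7)[OF v] by (auto simp: alg_le_def)
  qed
  show ?thesis
  proof (cases "\<phi>s = []")
    case True
    then show ?thesis
      unfolding RL_conseq_singleton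
      by (auto simp: RL_conseq_def RL_conseq_fin_def conj_list_def one hom_Fm_simps(5))
  next
    case False
    then show ?thesis
      using meet by (simp add: RL_conseq_def RL_conseq_fin_def)
  qed
qed

lemma RL_conseq_finitary:
  assumes "RL_conseq TYPE('u) \<Gamma> \<psi>"
  obtains \<phi>s where "set \<phi>s \<subseteq> \<Gamma>" "RL_conseq TYPE('u) {conj_list \<phi>s} \<psi>"
proof -
  obtain \<Delta> where \<Delta>: "\<Delta> \<subseteq> \<Gamma>" "finite \<Delta>" "RL_conseq TYPE('u) \<Delta> \<psi>"
    using assms by (auto simp: RL_conseq_def split: if_splits)
  moreover obtain \<phi>s where "set \<phi>s = \<Delta>" using \<Delta>(2) finite_list by auto
  ultimately show thesis using that RL_conseq_conj_list by blast
qed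

lemma RL_conseq_one: "RL_conseq TYPE('u) {} \<^bold>1"
proof -
  have "RL_conseq TYPE('u) {\<^bold>1} \<^bold>1"
    by (rule RL_conseq_singletonI) (simp add: residuated_preorder.refl hom_Fm_simps(7))
  then show ?thesis using RL_conseq_conj_list[where 'u = 'u, of "[]"] by (simp add: conj_list_def)
qed

lemma RL_conseq_wedge: "RL_conseq TYPE('u) {\<phi>, \<psi>} (\<phi> \<^bold>\<and> \<psi>)"
proof -
  have "RL_conseq TYPE('u) {\<phi> \<^bold>\<and> (\<psi> \<^bold>\<and> \<^bold>1)} (\<phi> \<^bold>\<and> \<psi>)"
  proof (rule RL_conseq_singletonI)
    fix A :: "'u alg" and v
    assume "residuated_preorder A (alg_le A)" and v: "v \<in> alg_hom Fm A"
    then interpret residuated_preorder A "alg_le A" by simp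
    show "alg_le A (v (\<phi> \<^bold>\<and> (\<psi> \<^bold>\<and> \<^bold>1))) (v (\<phi> \<^bold>\<and> \<psi>))"
      unfolding hom_Fm_simps[OF v]
      by (rule wedge_mono) (use hom_Fm_simps(7)[OF v] refl wedge_le1 in auto)
  qed
  then show ?thesis using RL_conseq_conj_list[where 'u = 'u, of "[\<phi>, \<psi>]"] by (simp add: conj_list_def)
qed

text \<open>Every consequence uses finitely many premises, and these can be merged by
  \<open>conj_list\<close>. Closure under \<open>1\<close> and meets keeps the value of that
  conjunction in \<open>F\<close>, which leaves only consequences from one premise to be checked.
  \<open>B\<close> is an arbitrary algebra here, so no order is available yet.\<close>

lemma logic_filter_RL_iff:
  assumes B: "algebra B"
  shows "logic_filter (RL_conseq TYPE('u)) B F \<longleftrightarrow>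
    F \<subseteq> carrier B \<and> \<one>\<^bsub>B\<^esub> \<in> F \<and> (\<forall>a\<in>F. \<forall>b\<in>F. wedge B a b \<in> F) \<and>
    (\<forall>v\<in>alg_hom Fm B. \<forall>\<alpha> \<beta>. RL_conseq TYPE('u) {\<alpha>} \<beta> \<longrightarrow> v \<alpha> \<in> F \<longrightarrow> v \<beta> \<in> F)"
    (is "?L \<longleftrightarrow> ?R")
proof
  assume L: ?L
  then have sub: "F \<subseteq> carrier B"
    and cl: "\<And>\<Gamma> \<phi> v. RL_conseq TYPE('u) \<Gamma> \<phi> \<Longrightarrow> v \<in> alg_hom Fm B \<Longrightarrow> v ` \<Gamma> \<subseteq> F \<Longrightarrow> v \<phi> \<in> F"
    by (auto simp: logic_filter_def)
  have "\<one>\<^bsub>B\<^esub> \<in> carrier B" using B by (simp add: algebra_def)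
  then obtain v where v: "v \<in> alg_hom Fm B" using hom_assigning[OF B] by metis
  have "\<one>\<^bsub>B\<^esub> \<in> F" using cl[OF RL_conseq_one v] by (simp add: hom_Fm_simps[OF v])
  moreover have "wedge B a b \<in> F" if ab: "a \<in> F" "b \<in> F" for a b
  proof -
    obtain w where w: "w \<in> alg_hom Fm B" "w (Var 0) = a" "w (Var 1) = b"
      using hom_assigning[OF B, of a b b] ab sub by blast
    then show ?thesis
      using cl[OF RL_conseq_wedge[of "Var 0" "Var 1"] w(1)] ab by (simp add: hom_Fm_simps[OF w(1)])
  qed
  moreover have "v \<beta> \<in> F" if "v \<in> alg_hom Fm B" "RL_conseq TYPE('u) {\<alpha>} \<beta>" "v \<alpha> \<in> F" for v \<alpha> \<beta>
    using cl[OF that(2,1)] that(3) by simp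
  ultimately show ?R using sub by blast
next
  assume R: ?R
  have "v \<psi> \<in> F" if L: "RL_conseq TYPE('u) \<Gamma> \<psi>" and v: "v \<in> alg_hom Fm B" and s: "v ` \<Gamma> \<subseteq> F" for \<Gamma> \<psi> v
  proof -
    obtain \<phi>s where \<phi>s: "set \<phi>s \<subseteq> \<Gamma>" "RL_conseq TYPE('u) {conj_list \<phi>s} \<psi>"
      using L by (rule RL_conseq_finitary)
    have "v (conj_list \<phi>s) \<in> F"
      using \<phi>s(1) s R by (induction \<phi>s) (auto simp: conj_list_def hom_Fm_simps[OF v])
    then show ?thesis using R \<phi>s(2) v by blast
  qed
  then show ?L using R by (auto simp: logic_filter_def)
qed

text \<open>On a residuated lattice the filters of the logic are the lattice filters. Infinity of
  \<open>'u\<close> enters through \<open>RL_conseq_transfer\<close>: \<open>B\<close> lives over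
  another type, and a consequence over \<open>'u\<close> must hold as an inequality in
  \<open>B\<close>.\<close>

lemma logic_filter_residuated_lattice_iff:
  fixes B :: "'b alg"
  assumes inf: "infinite (UNIV :: 'u set)" and r: "residuated_lattice B"
  shows "logic_filter (RL_conseq TYPE('u)) B F \<longleftrightarrow>
    F \<subseteq> carrier B \<and> \<one>\<^bsub>B\<^esub> \<in> F \<and> (\<forall>a\<in>F. \<forall>b\<in>F. wedge B a b \<in> F) \<and>
    (\<forall>a\<in>F. \<forall>b\<in>carrier B. alg_le B a b \<longrightarrow> b \<in> F)"
proof -
  have B: "algebra B" using r by (simp add: residuated_lattice_def)
  have "b \<in> F"
    if F: "logic_filter (RL_conseq TYPE('u)) B F" and ab: "a \<in> F" "b \<in> carrier B" "alg_le B a b"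
    for a b
  proof -
    \<comment> \<open>If \<open>a\<close> lies below \<open>b\<close>, then \<open>a\<close> is
      itself the meet of \<open>a\<close> and \<open>b\<close>, so this consequence leads from
      \<open>a\<close> to \<open>b\<close>.\<close>
    have *: "RL_conseq TYPE('u) {Var 0 \<^bold>\<and> Var 1} (Var 1)"
      by (rule RL_conseq_singletonI) (simp add: residuated_preorder.wedge_le2 hom_Fm_simps)
    have "a \<in> carrier B" using F ab by (auto simp: logic_filter_def)
    then obtain v where v: "v \<in> alg_hom Fm B" "v (Var 0) = a" "v (Var 1) = b"
      using hom_assigning[OF B, of a b b] ab by blast
    have "v (Var 0 \<^bold>\<and> Var 1) \<in> F"
      using v ab by (simp only: hom_Fm_simps[OF v(1)] alg_le_def)
    then show ?thesis
      using F v * unfolding logic_filter_RL_iff[OF B] by blast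
  qed
  moreover have "v \<beta> \<in> F"
    if "\<forall>a\<in>F. \<forall>b\<in>carrier B. alg_le B a b \<longrightarrow> b \<in> F" "v \<in> alg_hom Fm B"
      "RL_conseq TYPE('u) {\<alpha>} \<beta>" "v \<alpha> \<in> F" for v \<alpha> \<beta>
    using RL_conseq_singletonD[OF RL_conseq_transfer[OF inf that(3)] r that(2)]
      that hom_Fm_simps(7)[OF that(2)] by blast
  ultimately show ?thesis
    using logic_filter_RL_iff[OF B, where 'u = 'u, of F] by blast
qed

section \<open>The consequence preorder of an algebra\<close>

text \<open>Two consecutive steps may use different homomorphisms, and different formulas for the
  element at which they meet. Hence they do not compose in an evident way, and
  \<open>conseq_le\<close> adds transitivity by closure.\<close>

definition conseq_step :: "'u itself \<Rightarrow> 'b alg \<Rightarrow> 'b \<Rightarrow> 'b \<Rightarrow> bool" where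
  "conseq_step U B a b \<longleftrightarrow>
     (\<exists>v\<in>alg_hom Fm B. \<exists>\<alpha> \<beta>. RL_conseq U {\<alpha>} \<beta> \<and> a = v \<alpha> \<and> b = v \<beta>)"

definition conseq_le :: "'u itself \<Rightarrow> 'b alg \<Rightarrow> 'b \<Rightarrow> 'b \<Rightarrow> bool" where
  "conseq_le U B = (conseq_step U B)\<^sup>*\<^sup>*"

lemma conseq_leI:
  "RL_conseq U {\<alpha>} \<beta> \<Longrightarrow> v \<in> alg_hom Fm B \<Longrightarrow> conseq_le U B (v \<alpha>) (v \<beta>)"
  unfolding conseq_le_def by (rule r_into_rtranclp) (auto simp: conseq_step_def)

lemma conseq_le_trans:
  "conseq_le U B a b \<Longrightarrow> conseq_le U B b c \<Longrightarrow> conseq_le U B a c"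
  unfolding conseq_le_def by (rule rtranclp_trans)

text \<open>The homomorphism witnessing a step may miss \<open>c\<close>. Since the logic is
  invariant under renaming of variables, the step can be rewritten with a variable to spare, and
  that variable is sent to \<open>c\<close>.\<close>

lemma conseq_step_param:
  assumes B: "algebra B" and s: "conseq_step TYPE('u) B a b" and c: "c \<in> carrier B"
  obtains v \<alpha> \<beta> \<gamma> where "v \<in> alg_hom Fm B" "RL_conseq TYPE('u) {\<alpha>} \<beta>"
    "a = v \<alpha>" "b = v \<beta>" "c = v \<gamma>"
proof -
  obtain v \<alpha> \<beta> where v: "v \<in> alg_hom Fm B" "RL_conseq TYPE('u) {\<alpha>} \<beta>" "a = v \<alpha>" "b = v \<beta>"
    using s by (auto simp: conseq_step_def)
  \<comment> \<open>\<open>Var 0\<close> goes to \<open>c\<close>, and each successor variable goes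
    where \<open>v\<close> sent its predecessor, so shifted formulas keep their old values.\<close>
  let ?w = "fm_eval B (case_nat c (v \<circ> Var))"
  have w: "?w (shift \<phi>) = v \<phi>" for \<phi>
    using hom_eq_fm_eval[OF v(1)] by (metis fm_eval_shift)
  show thesis
  proof
    show "?w \<in> alg_hom Fm B"
      by (rule fm_eval_hom[OF B]) (simp add: c hom_Fm_simps[OF v(1)] split: nat.split)
    have "alg_le A (u (shift \<alpha>)) (u (shift \<beta>))"
      if "residuated_lattice A" "u \<in> alg_hom Fm A" for A :: "'u alg" and u
      using RL_conseq_singletonD[OF v(2) that(1) alg_hom_comp[OF shift_hom that(2)]] by simp
    then show "RL_conseq TYPE('u) {shift \<alpha>} (shift \<beta>)" by (simp add: RL_conseq_singleton)
    show "a = ?w (shift \<alpha>)" "b = ?w (shift \<beta>)" "c = ?w (Var 0)" by (simp_all add: w v)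
  qed
qed

text \<open>Here \<open>f\<close> is an operation on formulas with a parameter and \<open>g\<close>
  its interpretation in \<open>B\<close>. The formula standing for \<open>c\<close> changes from one
  step of the chain to the next, which is why \<open>f\<close> must respect entailment for every
  \<open>\<gamma>\<close>.\<close>

lemma conseq_le_translate:
  assumes B: "algebra B" and c: "c \<in> carrier B" and le: "conseq_le TYPE('u) B a b"
    and f: "\<And>\<alpha> \<beta> \<gamma>. RL_conseq TYPE('u) {\<alpha>} \<beta> \<Longrightarrow> RL_conseq TYPE('u) {f \<alpha> \<gamma>} (f \<beta> \<gamma>)"
    and g: "\<And>v \<alpha> \<gamma>. v \<in> alg_hom Fm B \<Longrightarrow> v (f \<alpha> \<gamma>) = g (v \<alpha>) (v \<gamma>)"
  shows "conseq_le TYPE('u) B (g a c) (g b c)"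
  using le unfolding conseq_le_def
proof (induction rule: rtranclp_induct)
  case (step y z)
  obtain v \<alpha> \<beta> \<gamma> where v: "v \<in> alg_hom Fm B" "RL_conseq TYPE('u) {\<alpha>} \<beta>"
      "y = v \<alpha>" "z = v \<beta>" "c = v \<gamma>"
    using conseq_step_param[OF B step(2) c] by blast
  have "conseq_step TYPE('u) B (g y c) (g z c)"
    unfolding conseq_step_def using v(1) f[OF v(2), of \<gamma>] g[OF v(1)] v(3-5) by metis
  then show ?case using step(3) by simp
qed simp

text \<open>In every residuated lattice an entailment from one premise is an inequality, and the
  operations preserve it in the listed arguments. So entailments are preserved, and translation
  carries this to chains in \<open>B\<close>.\<close>

lemma conseq_le_mono:
  assumes B: "algebra B" and c: "c \<in> carrier B" and le: "conseq_le TYPE('u) B a b"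
  shows "conseq_le TYPE('u) B (wedge B a c) (wedge B b c)"
    "conseq_le TYPE('u) B (wedge B c a) (wedge B c b)"
    "conseq_le TYPE('u) B (vee B a c) (vee B b c)"
    "conseq_le TYPE('u) B (vee B c a) (vee B c b)"
    "conseq_le TYPE('u) B (a \<otimes>\<^bsub>B\<^esub> c) (b \<otimes>\<^bsub>B\<^esub> c)"
    "conseq_le TYPE('u) B (imp B c a) (imp B c b)"
proof -
  have L: "RL_conseq TYPE('u) {\<alpha> \<^bold>\<and> \<gamma>} (\<beta> \<^bold>\<and> \<gamma>)" "RL_conseq TYPE('u) {\<gamma> \<^bold>\<and> \<alpha>} (\<gamma> \<^bold>\<and> \<beta>)"
    "RL_conseq TYPE('u) {\<alpha> \<^bold>\<or> \<gamma>} (\<beta> \<^bold>\<or> \<gamma>)" "RL_conseq TYPE('u) {\<gamma> \<^bold>\<or> \<alpha>} (\<gamma> \<^bold>\<or> \<beta>)"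
    "RL_conseq TYPE('u) {\<alpha> \<^bold>\<star> \<gamma>} (\<beta> \<^bold>\<star> \<gamma>)" "RL_conseq TYPE('u) {\<gamma> \<^bold>\<rightarrow> \<alpha>} (\<gamma> \<^bold>\<rightarrow> \<beta>)"
    if "RL_conseq TYPE('u) {\<alpha>} \<beta>" for \<alpha> \<beta> \<gamma>
  proof -
    {
      fix A :: "'u alg" and v
      assume r: "residuated_lattice A" and v: "v \<in> alg_hom Fm A"
      interpret residuated_preorder A "alg_le A" using r by (rule residuated_preorder_alg_le)
      note RL_conseq_singletonD[OF that r v]
      then have "alg_le A (v (\<alpha> \<^bold>\<and> \<gamma>)) (v (\<beta> \<^bold>\<and> \<gamma>))" "alg_le A (v (\<gamma> \<^bold>\<and> \<alpha>)) (v (\<gamma> \<^bold>\<and> \<beta>))"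
        "alg_le A (v (\<alpha> \<^bold>\<or> \<gamma>)) (v (\<beta> \<^bold>\<or> \<gamma>))" "alg_le A (v (\<gamma> \<^bold>\<or> \<alpha>)) (v (\<gamma> \<^bold>\<or> \<beta>))"
        "alg_le A (v (\<alpha> \<^bold>\<star> \<gamma>)) (v (\<beta> \<^bold>\<star> \<gamma>))" "alg_le A (v (\<gamma> \<^bold>\<rightarrow> \<alpha>)) (v (\<gamma> \<^bold>\<rightarrow> \<beta>))"
        by (simp_all add: hom_Fm_simps[OF v] refl wedge_mono vee_mono mult_left_mono imp_right_mono)
    }
    then show "RL_conseq TYPE('u) {\<alpha> \<^bold>\<and> \<gamma>} (\<beta> \<^bold>\<and> \<gamma>)" "RL_conseq TYPE('u) {\<gamma> \<^bold>\<and> \<alpha>} (\<gamma> \<^bold>\<and> \<beta>)"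
      "RL_conseq TYPE('u) {\<alpha> \<^bold>\<or> \<gamma>} (\<beta> \<^bold>\<or> \<gamma>)" "RL_conseq TYPE('u) {\<gamma> \<^bold>\<or> \<alpha>} (\<gamma> \<^bold>\<or> \<beta>)"
      "RL_conseq TYPE('u) {\<alpha> \<^bold>\<star> \<gamma>} (\<beta> \<^bold>\<star> \<gamma>)" "RL_conseq TYPE('u) {\<gamma> \<^bold>\<rightarrow> \<alpha>} (\<gamma> \<^bold>\<rightarrow> \<beta>)"
      by (simp_all add: RL_conseq_singleton)
  qed
  note tr = conseq_le_translate[OF B c le]
  show "conseq_le TYPE('u) B (wedge B a c) (wedge B b c)"
    by (rule tr[where f = "\<lambda>\<alpha> \<gamma>. \<alpha> \<^bold>\<and> \<gamma>" and g = "\<lambda>x y. wedge B x y"]) (simp_all add: L hom_Fm_simps)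
  show "conseq_le TYPE('u) B (wedge B c a) (wedge B c b)"
    by (rule tr[where f = "\<lambda>\<alpha> \<gamma>. \<gamma> \<^bold>\<and> \<alpha>" and g = "\<lambda>x y. wedge B y x"]) (simp_all add: L hom_Fm_simps)
  show "conseq_le TYPE('u) B (vee B a c) (vee B b c)"
    by (rule tr[where f = "\<lambda>\<alpha> \<gamma>. \<alpha> \<^bold>\<or> \<gamma>" and g = "\<lambda>x y. vee B x y"]) (simp_all add: L hom_Fm_simps)
  show "conseq_le TYPE('u) B (vee B c a) (vee B c b)"
    by (rule tr[where f = "\<lambda>\<alpha> \<gamma>. \<gamma> \<^bold>\<or> \<alpha>" and g = "\<lambda>x y. vee B y x"]) (simp_all add: L hom_Fm_simps)
  show "conseq_le TYPE('u) B (a \<otimes>\<^bsub>B\<^esub> c) (b \<otimes>\<^bsub>B\<^esub> c)"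
    by (rule tr[where f = "\<lambda>\<alpha> \<gamma>. \<alpha> \<^bold>\<star> \<gamma>" and g = "\<lambda>x y. x \<otimes>\<^bsub>B\<^esub> y"]) (simp_all add: L hom_Fm_simps)
  show "conseq_le TYPE('u) B (imp B c a) (imp B c b)"
    by (rule tr[where f = "\<lambda>\<alpha> \<gamma>. \<gamma> \<^bold>\<rightarrow> \<alpha>" and g = "\<lambda>x y. imp B y x"]) (simp_all add: L hom_Fm_simps)
qed

lemma residuated_preorder_conseq_le:
  assumes B: "algebra B"
  shows "residuated_preorder B (conseq_le TYPE('u) B)"
proof -
  let ?x = "Var 0" and ?y = "Var 1" and ?z = "Var 2"
  have cl [simp]: "wedge B a b \<in> carrier B" "vee B a b \<in> carrier B"
      "a \<otimes>\<^bsub>B\<^esub> b \<in> carrier B" "imp B a b \<in> carrier B" "\<one>\<^bsub>B\<^esub> \<in> carrier B"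
    if "a \<in> carrier B" "b \<in> carrier B" for a b
    using that B by (auto simp: algebra_def)
  have refl: "conseq_le TYPE('u) B a a" for a by (simp add: conseq_le_def)
  note trans = conseq_le_trans[of "TYPE('u)" B]
  note mono = conseq_le_mono[OF B, where 'u = 'u]
  \<comment> \<open>Only laws without premises can be read off from entailments. The rules are
    recovered from them by monotonicity: meets from \<open>a \<preceq> a \<and> a\<close>, joins
    from \<open>a \<or> a \<preceq> a\<close>, residuation from the unit and counit of the
    adjunction, detachment from \<open>a \<preceq> 1 \<star> a\<close>.\<close>
  have ent: "conseq_le TYPE('u) B (wedge B a b) a" "conseq_le TYPE('u) B (wedge B a b) b"
    "conseq_le TYPE('u) B a (wedge B a a)"
    "conseq_le TYPE('u) B a (vee B a b)" "conseq_le TYPE('u) B b (vee B a b)"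
    "conseq_le TYPE('u) B (vee B a a) a"
    "conseq_le TYPE('u) B a \<one>\<^bsub>B\<^esub>" "conseq_le TYPE('u) B \<one>\<^bsub>B\<^esub> (imp B a a)"
    "conseq_le TYPE('u) B a (\<one>\<^bsub>B\<^esub> \<otimes>\<^bsub>B\<^esub> a)"
    "conseq_le TYPE('u) B (imp B a b \<otimes>\<^bsub>B\<^esub> a) b"
    "conseq_le TYPE('u) B a (imp B b (a \<otimes>\<^bsub>B\<^esub> b))"
    "conseq_le TYPE('u) B (imp B a (imp B b c)) (imp B b (imp B a c))"
    if abc: "a \<in> carrier B" "b \<in> carrier B" "c \<in> carrier B" for a b c
  proof -
    have L: "RL_conseq TYPE('u) {?x \<^bold>\<and> ?y} ?x" "RL_conseq TYPE('u) {?x \<^bold>\<and> ?y} ?y"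
      "RL_conseq TYPE('u) {?x} (?x \<^bold>\<and> ?x)"
      "RL_conseq TYPE('u) {?x} (?x \<^bold>\<or> ?y)" "RL_conseq TYPE('u) {?y} (?x \<^bold>\<or> ?y)"
      "RL_conseq TYPE('u) {?x \<^bold>\<or> ?x} ?x"
      "RL_conseq TYPE('u) {?x} \<^bold>1" "RL_conseq TYPE('u) {\<^bold>1} (?x \<^bold>\<rightarrow> ?x)"
      "RL_conseq TYPE('u) {?x} (\<^bold>1 \<^bold>\<star> ?x)"
      "RL_conseq TYPE('u) {(?x \<^bold>\<rightarrow> ?y) \<^bold>\<star> ?x} ?y"
      "RL_conseq TYPE('u) {?x} (?y \<^bold>\<rightarrow> (?x \<^bold>\<star> ?y))"
      "RL_conseq TYPE('u) {?x \<^bold>\<rightarrow> (?y \<^bold>\<rightarrow> ?z)} (?y \<^bold>\<rightarrow> (?x \<^bold>\<rightarrow> ?z))"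
      by (rule RL_conseq_singletonI, simp add: hom_Fm_simps residuated_preorder.refl
          residuated_preorder.wedge_le1 residuated_preorder.wedge_le2 residuated_preorder.le_wedgeI
          residuated_preorder.vee_ge1 residuated_preorder.vee_ge2 residuated_preorder.vee_leI
          residuated_preorder.le_one residuated_preorder.one_le_imp_refl
          residuated_preorder.le_one_mult residuated_preorder.mult_imp_le
          residuated_preorder.le_imp_mult residuated_preorder.exchange)+
    obtain v where v: "v \<in> alg_hom Fm B" "v ?x = a" "v ?y = b" "v ?z = c"
      using hom_assigning[OF B abc] by blast
    note R = L[THEN conseq_leI, OF v(1), unfolded hom_Fm_simps[OF v(1)] v(2-4)]
    show "conseq_le TYPE('u) B (wedge B a b) a" "conseq_le TYPE('u) B (wedge B a b) b"
      "conseq_le TYPE('u) B a (wedge B a a)"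
      "conseq_le TYPE('u) B a (vee B a b)" "conseq_le TYPE('u) B b (vee B a b)"
      "conseq_le TYPE('u) B (vee B a a) a"
      "conseq_le TYPE('u) B a \<one>\<^bsub>B\<^esub>" "conseq_le TYPE('u) B \<one>\<^bsub>B\<^esub> (imp B a a)"
      "conseq_le TYPE('u) B a (\<one>\<^bsub>B\<^esub> \<otimes>\<^bsub>B\<^esub> a)"
      "conseq_le TYPE('u) B (imp B a b \<otimes>\<^bsub>B\<^esub> a) b"
      "conseq_le TYPE('u) B a (imp B b (a \<otimes>\<^bsub>B\<^esub> b))"
      "conseq_le TYPE('u) B (imp B a (imp B b c)) (imp B b (imp B a c))"
      by (rule R)+
  qed
  show ?thesis
  proof
    show "conseq_le TYPE('u) B a c" if "conseq_le TYPE('u) B a b" "conseq_le TYPE('u) B b c" for a b c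
      using that by (rule trans)
  next
    fix a b c assume abc: "a \<in> carrier B" "b \<in> carrier B" "c \<in> carrier B"
    note ent_abc = ent[OF abc]
    show "conseq_le TYPE('u) B a (wedge B b c)"
      if "conseq_le TYPE('u) B a b" "conseq_le TYPE('u) B a c"
      using trans[OF ent_abc(3) trans[OF mono(1)[OF abc(1) that(1)] mono(2)[OF abc(2) that(2)]]] .
    show "conseq_le TYPE('u) B (vee B a b) c"
      if "conseq_le TYPE('u) B a c" "conseq_le TYPE('u) B b c"
      using trans[OF trans[OF mono(3)[OF abc(2) that(1)] mono(4)[OF abc(3) that(2)]]]
        ent(6)[OF abc(3) abc(3) abc(3)] by blast
    show "conseq_le TYPE('u) B (a \<otimes>\<^bsub>B\<^esub> b) c = conseq_le TYPE('u) B a (imp B b c)"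
      using trans[OF ent_abc(11) mono(6)[OF abc(2)]]
        trans[OF mono(5)[OF abc(2)] ent(10)[OF abc(2,3,1)]] by blast
    show "conseq_le TYPE('u) B (imp B a (imp B b c)) (imp B b (imp B a c))" by (rule ent_abc)
  next
    fix a b assume ab: "a \<in> carrier B" "b \<in> carrier B"
    note ent_ab = ent[OF ab ab(1)]
    show "conseq_le TYPE('u) B a b" if "conseq_le TYPE('u) B \<one>\<^bsub>B\<^esub> (imp B a b)"
      using trans[OF ent_ab(9) trans[OF mono(5)[OF ab(1) that] ent_ab(10)]] .
    show "conseq_le TYPE('u) B (wedge B a b) a" "conseq_le TYPE('u) B (wedge B a b) b"
      "conseq_le TYPE('u) B a (vee B a b)" "conseq_le TYPE('u) B b (vee B a b)"
      by (rule ent_ab)+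
  qed (use B refl ent in auto)
qed

lemma logic_filter_upward:
  assumes B: "algebra B" and F: "logic_filter (RL_conseq TYPE('u)) B F"
    and le: "conseq_le TYPE('u) B a b" and a: "a \<in> F"
  shows "b \<in> F"
  using le a unfolding conseq_le_def
proof (induction rule: rtranclp_induct)
  case (step y z)
  then show ?case using F unfolding logic_filter_RL_iff[OF B] conseq_step_def by blast
qed

text \<open>With \<open>logic_filter_upward\<close> this shows that the up-set of \<open>a\<close>
  is the least filter containing \<open>a\<close>, so \<open>conseq_le\<close> is exactly membership
  in a filter with one generator.\<close>

lemma principal_logic_filter:
  assumes B: "algebra B" and a: "a \<in> carrier B"
  shows "logic_filter (RL_conseq TYPE('u)) B {b \<in> carrier B. conseq_le TYPE('u) B a b}"
proof -
  interpret residuated_preorder B "conseq_le TYPE('u) B"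
    using B by (rule residuated_preorder_conseq_le)
  show ?thesis
    unfolding logic_filter_RL_iff[OF B]
    using a by (auto simp: le_one le_wedgeI hom_Fm_simps intro: conseq_le_trans conseq_leI)
qed

section \<open>Full g-models are models of the Gentzen system\<close>

lemma gclosure_mono: "X \<subseteq> Y \<Longrightarrow> gclosure \<C> X \<subseteq> gclosure \<C> Y"
  by (auto simp: gclosure_def)

lemma gclosure_superset: "X \<subseteq> gclosure \<C> X"
  by (auto simp: gclosure_def)

lemma gclosure_least: "T \<in> \<C> \<Longrightarrow> X \<subseteq> T \<Longrightarrow> gclosure \<C> X \<subseteq> T"
  by (auto simp: gclosure_def)

lemma gclosure_absorb: "Y \<subseteq> gclosure \<C> X \<Longrightarrow> gclosure \<C> Y \<subseteq> gclosure \<C> X"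
  unfolding gclosure_def by blast

lemma full_gmodel_imp_gentzen_model:
  fixes A :: "'a alg"
  assumes full: "full_gmodel (RL_conseq TYPE('u)) A \<C>"
  shows "gentzen_model G_RL A \<C> \<and> finitary_gmatrix A \<C>"
proof -
  let ?L = "RL_conseq TYPE('u)"
  obtain B :: "'a alg" and h where gm: "gmatrix A \<C>" and B: "algebra B" and h: "h \<in> alg_hom A B"
    and C: "\<C> = {h -` F \<inter> carrier A | F. logic_filter ?L B F}"
    using full by (auto simp: full_gmodel_def)
  interpret residuated_preorder B "conseq_le TYPE('u) B"
    using B by (rule residuated_preorder_conseq_le)
  let ?le = "conseq_le TYPE('u) B"
  have hc: "h x \<in> carrier B" if "x \<in> carrier A" for x using h that by (auto simp: alg_hom_def)
  \<comment> \<open>Closure on \<open>A\<close> is rewritten as a statement about filters of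
    \<open>B\<close>, so that all later work takes place in \<open>B\<close>.\<close>
  have cl: "x \<in> gclosure \<C> X \<longleftrightarrow> (\<forall>F. logic_filter ?L B F \<longrightarrow> h ` X \<subseteq> F \<longrightarrow> h x \<in> F)"
    if "X \<subseteq> carrier A" "x \<in> carrier A" for X x
  proof -
    have "x \<in> gclosure \<C> X \<longleftrightarrow> (\<forall>T\<in>\<C>. X \<subseteq> T \<longrightarrow> x \<in> T)" by (auto simp: gclosure_def)
    also have "\<dots> \<longleftrightarrow> (\<forall>F. logic_filter ?L B F \<longrightarrow> X \<subseteq> h -` F \<inter> carrier A \<longrightarrow> x \<in> h -` F \<inter> carrier A)"
      unfolding C by blast
    also have "\<dots> \<longleftrightarrow> (\<forall>F. logic_filter ?L B F \<longrightarrow> h ` X \<subseteq> F \<longrightarrow> h x \<in> F)"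
      using that by (simp add: image_subset_iff_subset_vimage)
    finally show ?thesis .
  qed
  have clc: "gclosure \<C> X \<subseteq> carrier A" if "X \<subseteq> carrier A" for X
    using gm that by (intro gclosure_least) (auto simp: gmatrix_def)
  have F1: "\<one>\<^bsub>B\<^esub> \<in> F" "\<And>a b. a \<in> F \<Longrightarrow> b \<in> F \<Longrightarrow> wedge B a b \<in> F" if "logic_filter ?L B F" for F
    using that by (auto simp: logic_filter_RL_iff[OF B])
  have single: "(\<forall>F. logic_filter ?L B F \<longrightarrow> a \<in> F \<longrightarrow> b \<in> F) \<longleftrightarrow> ?le a b"
    if "a \<in> carrier B" "b \<in> carrier B" for a b
  proof
    assume H: "\<forall>F. logic_filter ?L B F \<longrightarrow> a \<in> F \<longrightarrow> b \<in> F"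
    show "?le a b"
      using H[rule_format, OF principal_logic_filter[OF B that(1)]] that(1) refl by simp
  qed (use logic_filter_upward[OF B] in blast)
  \<comment> \<open>Every filter contains \<open>1\<close>, hence having no premises amounts to
    having the premise \<open>1\<close>.\<close>
  have empty: "(\<forall>F. logic_filter ?L B F \<longrightarrow> b \<in> F) \<longleftrightarrow> ?le \<one>\<^bsub>B\<^esub> b" if "b \<in> carrier B" for b
    using single[OF closed(5) that] F1(1) by blast
  have "rule_model A \<C> (p, q)" if r: "(p, q) \<in> G_RL" for p q
    unfolding rule_model_def
  proof (intro ballI impI)
    fix v assume v: "v \<in> alg_hom Fm A" and prem: "\<forall>s\<in>set (fst (p, q)). sequent_holds \<C> v s"
    define w where "w = h \<circ> v"
    have w: "w \<in> alg_hom Fm B" unfolding w_def using v h by (rule alg_hom_comp)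
    have holds: "sequent_holds \<C> v (\<Gamma> \<rhd> \<phi>) \<longleftrightarrow>
        (\<forall>F. logic_filter ?L B F \<longrightarrow> w ` fset \<Gamma> \<subseteq> F \<longrightarrow> w \<phi> \<in> F)" for \<Gamma> \<phi>
      using cl[of "v ` fset \<Gamma>" "v \<phi>"] hom_Fm_simps(7)[OF v] by (auto simp: w_def image_subset_iff)
    have holds1: "sequent_holds \<C> v ({|\<phi>|} \<rhd> \<psi>) \<longleftrightarrow> ?le (w \<phi>) (w \<psi>)"
      and holds0: "sequent_holds \<C> v ({||} \<rhd> \<psi>) \<longleftrightarrow> ?le \<one>\<^bsub>B\<^esub> (w \<psi>)" for \<phi> \<psi>
      unfolding holds using single[of "w \<phi>" "w \<psi>"] empty[of "w \<psi>"] hom_Fm_simps(7)[OF w] by simp_all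
    note ws = hom_Fm_simps[OF w]
    show "sequent_holds \<C> v (snd (p, q))"
      using r
    proof (cases rule: G_RL.cases)
      \<comment> \<open>This antecedent has two formulas, so the sequent is read on filters
        directly; the same holds for weakening and cut, whose antecedents are arbitrary. The other
        rules become statements about the preorder.\<close>
      case (wedge_I \<phi> \<psi>)
      then show ?thesis using F1(2) by (simp add: holds ws del: sequent_holds.simps)
    next
      case (vee_left \<phi> \<psi> \<xi>)
      then show ?thesis
        using prem trans[of "w \<phi>" "vee B (w \<phi>) (w \<psi>)" "w \<xi>"]
        by (simp add: holds1 ws vee_ge1 del: sequent_holds.simps)
    next
      case (vee_right \<phi> \<psi> \<xi>)
      then show ?thesis
        using prem trans[of "w \<psi>" "vee B (w \<phi>) (w \<psi>)" "w \<xi>"]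
        by (simp add: holds1 ws vee_ge2 del: sequent_holds.simps)
    next
      case (weakening \<Gamma> \<phi> \<psi>)
      then show ?thesis using prem by (simp add: holds del: sequent_holds.simps)
    next
      case (cut \<Gamma> \<phi> \<psi>)
      then show ?thesis using prem by (simp add: holds del: sequent_holds.simps)
    next
      case (detachment \<phi> \<psi>)
      then show ?thesis
        using prem by (simp add: holds0 holds1 ws one_le_imp_iff del: sequent_holds.simps)
    qed (use prem in \<open>simp_all add: holds1 holds0 ws refl wedge_le1 wedge_le2 one_le_imp_refl
        exchange vee_leI resid del: sequent_holds.simps\<close>)
  qed
  moreover have "finitary_gmatrix A \<C>"
    unfolding finitary_gmatrix_def
  proof (intro allI impI equalityI)
    fix X assume X: "X \<subseteq> carrier A"
    show "(\<Union>Y\<in>{Y. finite Y \<and> Y \<subseteq> X}. gclosure \<C> Y) \<subseteq> gclosure \<C> X"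
      using gclosure_mono by blast
    \<comment> \<open>The union of the filters generated by the images of the finite subsets of
      \<open>X\<close>. The union is directed, since two finite sets lie in their union; hence it is
      itself a filter, and it contains the image of \<open>X\<close>.\<close>
    define G where "G = {b \<in> carrier B. \<exists>Y. finite Y \<and> Y \<subseteq> X \<and>
      (\<forall>F. logic_filter ?L B F \<longrightarrow> h ` Y \<subseteq> F \<longrightarrow> b \<in> F)}"
    have GI: "b \<in> G" if "b \<in> carrier B" "finite Y" "Y \<subseteq> X"
      "\<And>F. logic_filter ?L B F \<Longrightarrow> h ` Y \<subseteq> F \<Longrightarrow> b \<in> F" for b Y
      using that by (auto simp: G_def)
    have Gc: "G \<subseteq> carrier B" by (auto simp: G_def)
    have "\<one>\<^bsub>B\<^esub> \<in> G" by (rule GI[of _ "{}"]) (auto intro: F1(1))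
    moreover have "wedge B a b \<in> G" if ab: "a \<in> G" "b \<in> G" for a b
    proof -
      obtain Y Z where YZ: "finite (Y \<union> Z)" "Y \<union> Z \<subseteq> X"
        "\<And>F. logic_filter ?L B F \<Longrightarrow> h ` Y \<subseteq> F \<Longrightarrow> a \<in> F"
        "\<And>F. logic_filter ?L B F \<Longrightarrow> h ` Z \<subseteq> F \<Longrightarrow> b \<in> F"
        using ab unfolding G_def by auto
      have "wedge B a b \<in> F" if "logic_filter ?L B F" "h ` (Y \<union> Z) \<subseteq> F" for F
        using F1(2) YZ(3,4) that by (simp add: image_Un)
      then show ?thesis using ab Gc by (intro GI[OF _ YZ(1,2)]) auto
    qed
    moreover have "v \<beta> \<in> G" if v: "v \<in> alg_hom Fm B" "?L {\<alpha>} \<beta>" "v \<alpha> \<in> G" for v \<alpha> \<beta>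
    proof -
      obtain Y where Y: "finite Y" "Y \<subseteq> X"
        "\<And>F. logic_filter ?L B F \<Longrightarrow> h ` Y \<subseteq> F \<Longrightarrow> v \<alpha> \<in> F"
        using v(3) unfolding G_def by auto
      have "v \<beta> \<in> F" if "logic_filter ?L B F" "h ` Y \<subseteq> F" for F
        using logic_filter_upward[OF B that(1) conseq_leI[OF v(2,1)] Y(3)[OF that]] .
      then show ?thesis by (rule GI[OF hom_Fm_simps(7)[OF v(1)] Y(1,2)])
    qed
    ultimately have G: "logic_filter ?L B G" using Gc by (simp add: logic_filter_RL_iff[OF B])
    have hG: "h ` X \<subseteq> G"
    proof (rule image_subsetI)
      show "h x \<in> G" if "x \<in> X" for x by (rule GI[of _ "{x}"]) (use that X hc in auto)
    qed
    show "gclosure \<C> X \<subseteq> (\<Union>Y\<in>{Y. finite Y \<and> Y \<subseteq> X}. gclosure \<C> Y)"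
    proof
      fix x assume x: "x \<in> gclosure \<C> X"
      then have xA: "x \<in> carrier A" using clc[OF X] by blast
      then have "h x \<in> G" using x G hG by (simp add: cl[OF X])
      then obtain Y where Y: "finite Y" "Y \<subseteq> X"
        "\<forall>F. logic_filter ?L B F \<longrightarrow> h ` Y \<subseteq> F \<longrightarrow> h x \<in> F"
        unfolding G_def by auto
      then have "x \<in> gclosure \<C> Y" using cl[of Y x] X xA by simp
      then show "x \<in> (\<Union>Y\<in>{Y. finite Y \<and> Y \<subseteq> X}. gclosure \<C> Y)" using Y by blast
    qed
  qed
  ultimately show ?thesis using gm by (auto simp: gentzen_model_def)
qed

section \<open>Models of the Gentzen system are full g-models\<close>

lemma gclosure_closed:
  assumes "gmatrix A \<C>" "X \<subseteq> carrier A"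
  shows "gclosure \<C> X \<in> \<C>"
proof -
  have "{T \<in> \<C>. X \<subseteq> T} \<subseteq> \<C>" "{T \<in> \<C>. X \<subseteq> T} \<noteq> {}" using assms by (auto simp: gmatrix_def)
  then show ?thesis using assms(1) unfolding gmatrix_def gclosure_def by blast
qed

text \<open>Rules speak of all homomorphisms; one that sends the first three variables to
  \<open>a\<close>, \<open>b\<close>, \<open>c\<close> turns them into statements about
  elements.\<close>

lemma gentzen_model_closure_rules:
  assumes G: "gentzen_model G_RL A \<C>" and abc: "a \<in> carrier A" "b \<in> carrier A" "c \<in> carrier A"
  shows "imp A a a \<in> gclosure \<C> {}" "\<one>\<^bsub>A\<^esub> \<in> gclosure \<C> {}"
    "wedge A a b \<in> gclosure \<C> {a, b}"
    "a \<in> gclosure \<C> {wedge A a b}" "b \<in> gclosure \<C> {wedge A a b}"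
    "imp A b (imp A a c) \<in> gclosure \<C> {imp A a (imp A b c)}"
    "imp A a b \<in> gclosure \<C> {} \<Longrightarrow> b \<in> gclosure \<C> {a}"
    "c \<in> gclosure \<C> {vee A a b} \<Longrightarrow> c \<in> gclosure \<C> {a}"
    "c \<in> gclosure \<C> {vee A a b} \<Longrightarrow> c \<in> gclosure \<C> {b}"
    "c \<in> gclosure \<C> {a} \<Longrightarrow> c \<in> gclosure \<C> {b} \<Longrightarrow> c \<in> gclosure \<C> {vee A a b}"
    "c \<in> gclosure \<C> {a \<otimes>\<^bsub>A\<^esub> b} \<Longrightarrow> imp A b c \<in> gclosure \<C> {a}"
    "imp A b c \<in> gclosure \<C> {a} \<Longrightarrow> c \<in> gclosure \<C> {a \<otimes>\<^bsub>A\<^esub> b}"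
proof -
  have A: "algebra A" using G by (auto simp: gentzen_model_def gmatrix_def)
  obtain v where v: "v \<in> alg_hom Fm A" "v (Var 0) = a" "v (Var 1) = b" "v (Var 2) = c"
    using hom_assigning[OF A abc] by blast
  have r: "\<forall>s\<in>set p. sequent_holds \<C> v s \<Longrightarrow> sequent_holds \<C> v q"
    if "(p, q) \<in> G_RL" for p q
    using G that v(1) by (fastforce simp: gentzen_model_def rule_model_def)
  \<comment> \<open>The simplifier rewrites the index \<open>1\<close> to \<open>Suc 0\<close>, so
    the values of the variables must be given in that form to apply.\<close>
  note [simp] = hom_Fm_simps[OF v(1)] v(2-4)[unfolded One_nat_def]
  let ?x = "Var 0" and ?y = "Var 1" and ?z = "Var 2"
  show "imp A a a \<in> gclosure \<C> {}" using r[OF imp_refl[of ?x]] by simp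
  show "\<one>\<^bsub>A\<^esub> \<in> gclosure \<C> {}" using r[OF unit] by simp
  show "wedge A a b \<in> gclosure \<C> {a, b}" using r[OF wedge_I[of ?x ?y]] by simp
  show "a \<in> gclosure \<C> {wedge A a b}" using r[OF wedge_E1[of ?x ?y]] by simp
  show "b \<in> gclosure \<C> {wedge A a b}" using r[OF wedge_E2[of ?x ?y]] by simp
  show "imp A b (imp A a c) \<in> gclosure \<C> {imp A a (imp A b c)}"
    using r[OF exchange[of ?x ?y ?z]] by simp
  show "imp A a b \<in> gclosure \<C> {} \<Longrightarrow> b \<in> gclosure \<C> {a}" using r[OF detachment[of ?x ?y]] by simp
  show "c \<in> gclosure \<C> {vee A a b} \<Longrightarrow> c \<in> gclosure \<C> {a}" using r[OF vee_left[of ?x ?y ?z]] by simp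
  show "c \<in> gclosure \<C> {vee A a b} \<Longrightarrow> c \<in> gclosure \<C> {b}" using r[OF vee_right[of ?x ?y ?z]] by simp
  show "c \<in> gclosure \<C> {a} \<Longrightarrow> c \<in> gclosure \<C> {b} \<Longrightarrow> c \<in> gclosure \<C> {vee A a b}"
    using r[OF vee_E[of ?x ?z ?y]] by simp
  show "c \<in> gclosure \<C> {a \<otimes>\<^bsub>A\<^esub> b} \<Longrightarrow> imp A b c \<in> gclosure \<C> {a}"
    using r[OF residI[of ?x ?y ?z]] by simp
  show "imp A b c \<in> gclosure \<C> {a} \<Longrightarrow> c \<in> gclosure \<C> {a \<otimes>\<^bsub>A\<^esub> b}"
    using r[OF residE[of ?x ?y ?z]] by simp
qed

lemma residuated_preorder_gclosure:
  assumes G: "gentzen_model G_RL A \<C>"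
  shows "residuated_preorder A (\<lambda>a b. b \<in> gclosure \<C> {a})"
proof -
  have A: "algebra A" using G by (auto simp: gentzen_model_def gmatrix_def)
  note rules = gentzen_model_closure_rules[OF G]
  have self: "a \<in> gclosure \<C> {a}" for a using gclosure_superset by fast
  have cl: "wedge A a b \<in> carrier A" "vee A a b \<in> carrier A" "\<one>\<^bsub>A\<^esub> \<in> carrier A"
    "a \<otimes>\<^bsub>A\<^esub> b \<in> carrier A" "imp A a b \<in> carrier A"
    if "a \<in> carrier A" "b \<in> carrier A" for a b
    using that A by (auto simp: algebra_def)
  have ext: "x \<in> gclosure \<C> X" if "x \<in> gclosure \<C> {}" for x X
    using gclosure_mono[of "{}" X] that by blast
  \<comment> \<open>As \<open>1\<close> belongs to the closure of the empty set, the premise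
    \<open>1\<close> adds nothing. This converts rules with empty antecedents into the axioms of the
    locale that mention \<open>1\<close>.\<close>
  have one: "gclosure \<C> {\<one>\<^bsub>A\<^esub>} \<subseteq> gclosure \<C> {}"
    using A by (intro gclosure_absorb) (auto simp: algebra_def intro!: rules(2))
  show ?thesis
  proof
    fix a b c assume abc: "a \<in> carrier A" "b \<in> carrier A" "c \<in> carrier A"
    show "b \<in> gclosure \<C> {a} \<Longrightarrow> c \<in> gclosure \<C> {b} \<Longrightarrow> c \<in> gclosure \<C> {a}"
      using gclosure_absorb[of "{b}" \<C> "{a}"] by blast
    show "b \<in> gclosure \<C> {a} \<Longrightarrow> c \<in> gclosure \<C> {a} \<Longrightarrow> wedge A b c \<in> gclosure \<C> {a}"
      using gclosure_absorb[of "{b, c}" \<C> "{a}"] rules(3)[OF abc(2,3,1)] by blast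
    show "c \<in> gclosure \<C> {a} \<Longrightarrow> c \<in> gclosure \<C> {b} \<Longrightarrow> c \<in> gclosure \<C> {vee A a b}"
      by (rule rules[OF abc])
    show "imp A b (imp A a c) \<in> gclosure \<C> {imp A a (imp A b c)}" by (rule rules[OF abc])
    show "(c \<in> gclosure \<C> {a \<otimes>\<^bsub>A\<^esub> b}) = (imp A b c \<in> gclosure \<C> {a})"
      using rules(11,12)[OF abc] by blast
  next
    fix a b assume ab: "a \<in> carrier A" "b \<in> carrier A"
    show "a \<in> gclosure \<C> {wedge A a b}" "b \<in> gclosure \<C> {wedge A a b}" by (rule rules[OF ab ab(1)])+
    \<comment> \<open>The two join rules are applied with the join itself as succedent, so their
      premise is an instance of reflexivity.\<close>
    show "vee A a b \<in> gclosure \<C> {a}" "vee A a b \<in> gclosure \<C> {b}"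
      using rules(8,9)[OF ab cl(2)[OF ab]] self by blast+
    show "imp A a b \<in> gclosure \<C> {\<one>\<^bsub>A\<^esub>} \<Longrightarrow> b \<in> gclosure \<C> {a}"
      using rules(7)[OF ab ab(1)] one by blast
  next
    fix a assume a: "a \<in> carrier A"
    show "imp A a a \<in> gclosure \<C> {\<one>\<^bsub>A\<^esub>}" "\<one>\<^bsub>A\<^esub> \<in> gclosure \<C> {a}"
      using rules(1,2)[OF a a a] ext by blast+
  qed (use A self in auto)
qed

text \<open>The required homomorphism is \<open>rep\<close> onto \<open>quot\<close>. As
  \<open>quot\<close> is a residuated lattice, its filters are the lattice filters, which can be
  compared with closed sets by means of \<open>quot_le\<close>.\<close>

lemma gentzen_model_imp_full_gmodel:
  fixes A :: "'a alg"
  assumes inf: "infinite (UNIV :: 'u set)"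
    and G: "gentzen_model G_RL A \<C>" and fin: "finitary_gmatrix A \<C>"
  shows "full_gmodel (RL_conseq TYPE('u)) A \<C>"
proof -
  let ?L = "RL_conseq TYPE('u)"
  have gm: "gmatrix A \<C>" using G by (simp add: gentzen_model_def)
  interpret residuated_preorder A "\<lambda>a b. b \<in> gclosure \<C> {a}"
    using G by (rule residuated_preorder_gclosure)
  note rules = gentzen_model_closure_rules[OF G]
  note filt = logic_filter_residuated_lattice_iff[OF inf residuated_lattice_quot]
  have one: "\<one>\<^bsub>A\<^esub> \<in> gclosure \<C> X" for X
    using rules(2)[OF closed(5,5,5)] gclosure_mono[of "{}" X] by blast
  have "\<C> = {rep -` F \<inter> carrier A | F. logic_filter ?L quot F}" (is "_ = ?R")
  proof (intro equalityI subsetI)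
    fix T assume T: "T \<in> \<C>"
    then have TA: "T \<subseteq> carrier A" using gm by (auto simp: gmatrix_def)
    have up: "b \<in> T" if "a \<in> T" "b \<in> gclosure \<C> {a}" for a b
      using gclosure_least[OF T, of "{a}"] that by blast
    have T1: "\<one>\<^bsub>A\<^esub> \<in> T" using gclosure_least[OF T, of "{}"] one by blast
    have Tw: "wedge A a b \<in> T" if "a \<in> T" "b \<in> T" for a b
      using gclosure_least[OF T, of "{a, b}"] rules(3)[of a b b] that TA by blast
    have "logic_filter ?L quot (rep ` T)"
      unfolding filt quot_carrier quot_one
    proof (intro conjI ballI impI)
      show "rep ` T \<subseteq> rep ` carrier A" using TA by blast
      show "rep \<one>\<^bsub>A\<^esub> \<in> rep ` T" using T1 by blast
    next
      fix x y assume "x \<in> rep ` T" "y \<in> rep ` T"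
      then obtain a b where ab: "a \<in> T" "b \<in> T" "x = rep a" "y = rep b" by blast
      then have "wedge quot x y = rep (wedge A a b)" using TA quot_simps(1) by blast
      then show "wedge quot x y \<in> rep ` T" using Tw ab by blast
    next
      fix x y assume "x \<in> rep ` T" "y \<in> rep ` carrier A" and le: "alg_le quot x y"
      then obtain a b where ab: "a \<in> T" "b \<in> carrier A" "x = rep a" "y = rep b" by blast
      then have "b \<in> gclosure \<C> {a}" using le quot_le[of a b] TA by blast
      then show "y \<in> rep ` T" using up ab by blast
    qed
    \<comment> \<open>A closed set is an up-set for the preorder, hence a union of equivalence
      classes; taking the image and then the inverse image adds no elements.\<close>
    moreover have "T = rep -` (rep ` T) \<inter> carrier A"
    proof (intro equalityI subsetI)
      fix x assume x: "x \<in> rep -` (rep ` T) \<inter> carrier A"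
      then obtain y where y: "y \<in> T" "rep x = rep y" by blast
      then have "x \<in> gclosure \<C> {y}" using rep_eq_iff[of x y] x TA by blast
      with y(1) show "x \<in> T" by (rule up)
    qed (use TA in auto)
    ultimately show "T \<in> ?R" by blast
  next
    fix T assume "T \<in> ?R"
    then obtain F where F: "logic_filter ?L quot F" and T: "T = rep -` F \<inter> carrier A" by blast
    note F' = F[unfolded filt]
    have T1: "\<one>\<^bsub>A\<^esub> \<in> T" using F' by (simp add: T quot_one)
    have Tw: "wedge A a b \<in> T" if "a \<in> T" "b \<in> T" for a b
    proof -
      have "wedge quot (rep a) (rep b) \<in> F" using F' that by (simp add: T)
      then show ?thesis using that by (simp add: T quot_simps)
    qed
    have up: "b \<in> T" if "a \<in> T" "b \<in> carrier A" "b \<in> gclosure \<C> {a}" for a b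
    proof -
      have "alg_le quot (rep a) (rep b)" using that quot_le[of a b] by (simp add: T)
      moreover have "rep a \<in> F" "rep b \<in> carrier quot" using that by (simp_all add: T quot_carrier)
      ultimately have "rep b \<in> F" using F' by blast
      then show ?thesis using that(2) by (simp add: T)
    qed
    have TA: "T \<subseteq> carrier A" by (simp add: T)
    \<comment> \<open>The meet of a finite subset of \<open>T\<close>, with \<open>1\<close> for the
      empty set, stays in \<open>T\<close> and generates the whole subset. This reduces finitely
      generated closures to closures of one element, which the preorder describes.\<close>
    have bound: "\<exists>m\<in>T. Y \<subseteq> gclosure \<C> {m}" if "finite Y" "Y \<subseteq> T" for Y
      using that
    proof (induction Y rule: finite_induct)
      case empty
      then show ?case using T1 by blast
    next
      case (insert y Y)
      then obtain m where m: "m \<in> T" "Y \<subseteq> gclosure \<C> {m}" by auto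
      have y: "y \<in> T" using insert by simp
      then have "y \<in> carrier A" "m \<in> carrier A" using m TA by auto
      then have w: "y \<in> gclosure \<C> {wedge A y m}" "m \<in> gclosure \<C> {wedge A y m}"
        by (simp_all add: wedge_le1 wedge_le2)
      have "gclosure \<C> {m} \<subseteq> gclosure \<C> {wedge A y m}"
        by (rule gclosure_absorb) (simp add: w)
      then have "insert y Y \<subseteq> gclosure \<C> {wedge A y m}" using w m(2) by simp
      then show ?case using Tw[OF y m(1)] by (rule rev_bexI[rotated])
    qed
    have finT: "gclosure \<C> Y \<subseteq> T" if Y: "finite Y" "Y \<subseteq> T" for Y
    proof -
      obtain m where m: "m \<in> T" "Y \<subseteq> gclosure \<C> {m}"
        using bound[OF Y] by blast
      have "gclosure \<C> Y \<subseteq> gclosure \<C> {m}" using m(2) by (rule gclosure_absorb)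
      moreover have "gclosure \<C> {m} \<subseteq> carrier A"
        using gm m(1) TA by (intro gclosure_least) (auto simp: gmatrix_def)
      ultimately show ?thesis using up[OF m(1)] by blast
    qed
    \<comment> \<open>Here finitarity enters: \<open>T\<close> contains the closures of its finite
      subsets, and these exhaust the closure of \<open>T\<close>.\<close>
    have "gclosure \<C> T = (\<Union>Y\<in>{Y. finite Y \<and> Y \<subseteq> T}. gclosure \<C> Y)"
      using fin TA by (simp add: finitary_gmatrix_def)
    also have "\<dots> \<subseteq> T" using finT by (intro UN_least) simp
    finally have "gclosure \<C> T = T" using gclosure_superset by (rule equalityI)
    then show "T \<in> \<C>" using gclosure_closed[OF gm TA] by simp
  qed
  then show ?thesis
    unfolding full_gmodel_def using gm algebra_quot rep_hom quot_carrier by blast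
qed

theorem theorem5p9:
  assumes "infinite (UNIV :: 'u set)"
  shows "fully_adequate TYPE('a) G_RL (RL_conseq TYPE('u))"
  unfolding fully_adequate_def has_theorems_def
  using RL_conseq_one full_gmodel_imp_gentzen_model gentzen_model_imp_full_gmodel[OF assms]
  by blast

end
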